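(* Let $T>0$, $\alpha>0$, $\Delta^0>0$, $\sigma\in(0,1)$, let $W\subset\mathbb{Z}$ be finite, and let $a$ be fixed with $0<a\le 1-\sigma<1$. Let $j:L^2(0,T)\to\mathbb{R}$ be bounded below and twice Fréchet differentiable such that there is $C>0$ with $|\nabla^2 j(w)(\psi,\phi)|\le C\|\psi\|_{L^2(0,T)}\|\phi\|_{L^2(0,T)}$ for all $w,\psi,\phi\in L^2(0,T)$. Let $\varepsilon\to0$ along a sequence of positive numbers and let $(w_\varepsilon)_\varepsilon\subset \mathrm{BV}_W(0,T)$ be the sequence of final iterates produced by the trust-region algorithm (described in the context) executed on $j_\varepsilon=j\circ K_\varepsilon$ in place of $j$, where each execution is initialized with the final iterate of the previous execution (the first one with an arbitrary element of $\mathrm{BV}_W(0,T)$), and where each execution is terminated if one of the following conditions is met: (i) the trust-region radius is smaller than $\Delta(\varepsilon)>0$, where $\Delta(\varepsilon)\to0$ as $\varepsilon\to0$; (ii) the predicted reduction is smaller than $\left(1-\frac{3a}{4}\right)\alpha>0$. If $\liminf_{\varepsilon\to0}\mathrm{TV}(w_\varepsilon)<\infty$, then $(w_\varepsilon)_\varepsilon$ has at least one weakly-$^*$ convergent subsequence. Every weakly-$^*$ convergent subsequence converges strictly to a limit point in $\mathrm{BV}_W(0,T)$.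
   Context: Total variation: $\mathrm{TV}(f)=\sup\{\int_0^T f\phi'\,dt : \phi\in C_c^1(0,T),\ \sup|\phi|\le 1\}$; $\mathrm{BV}(0,T)=\{f\in L^1(0,T):\mathrm{TV}(f)<\infty\}$; $\mathrm{BV}_W(0,T)=\{w\in\mathrm{BV}(0,T): w(t)\in W\text{ for a.a. }t\}$. $(w^n)\subset\mathrm{BV}(0,T)$ converges weakly-$^*$ to $w\in\mathrm{BV}(0,T)$ if $w^n\to w$ in $L^1(0,T)$ and $\limsup_n\mathrm{TV}(w^n)<\infty$; strictly if in addition $\mathrm{TV}(w^n)\to\mathrm{TV}(w)$. Mollification: $\eta_\varepsilon(t)=\varepsilon^{-1}\eta(t/\varepsilon)$ with the usual kernel $\eta\in C_c^\infty(\mathbb{R})$, $\eta\ge0$, $\int_{\mathbb{R}}\eta=1$, $\operatorname{supp}\eta\subset[-1,1]$; $K_\varepsilon(w)$ is the restriction to $[0,T]$ of $\eta_\varepsilon*w$, where $w$ is extended by $0$ outside $[0,T]$. Trust-region subproblem for a Fréchet differentiable $g:L^2(0,T)\to\mathbb{R}$, $w\in\mathrm{BV}_W(0,T)$ and $\Delta>0$, denoted $\mathrm{TR}(w,\Delta)$: minimize over $d\in L^2(0,T)$ the functional $\ell(w,d)=(\nabla g(w),d)_{L^2(0,T)}+\alpha\mathrm{TV}(w+d)-\alpha\mathrm{TV}(w)$ subject to $w(s)+d(s)\in W$ for a.a. $s\in(0,T)$ and $\|d\|_{L^1(0,T)}\le\Delta$. (Minimizers exist.) Trust-region algorithm on $g$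 with inputs $w^0\in\mathrm{BV}_W(0,T)$, $\Delta^0>0$, $\sigma\in(0,1)$: for outer iterations $n=1,2,\dots$ set $\Delta^{n,0}=\Delta^0$, and run the inner loop over $k=0,1,2,\dots$: let $d^{n,k}$ be a minimizer of $\mathrm{TR}(w^{n-1},\Delta^{n,k})$; the predicted reduction is $-\ell(w^{n-1},d^{n,k})$. If the predicted-reduction termination criterion (here (ii)) is met, terminate with final iterate $w^{n-1}$ (this replaces the original criterion "predicted reduction equals $0$"). Otherwise, if $$\frac{g(w^{n-1})+\alpha\mathrm{TV}(w^{n-1})-g(w^{n-1}+d^{n,k})-\alpha\mathrm{TV}(w^{n-1}+d^{n,k})}{-\ell(w^{n-1},d^{n,k})}<\sigma,$$ reject the step and set $\Delta^{n,k+1}=\Delta^{n,k}/2$; after this reduction the radius criterion (here (i)) is checked, and if it is met terminate with final iterate $w^{n-1}$; otherwise continue the inner loop. If the ratio is $\ge\sigma$, accept the step: set $w^n=w^{n-1}+d^{n,k}$, leave the inner loop and go to the next outer iteration. In the claim $g=j_\varepsilon$. Under the stated assumptions each execution terminates after finitely many iterations. *)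

theory Defs
  imports "HOL-Analysis.Analysis"
begin

section \<open>Lebesgue spaces on the interval $(0,T)$\<close>

text \<open>
  Since \<open>T\<close> is a variable, classes of functions on $(0,T)$ are represented by functions
  \<open>real \<Rightarrow> real\<close>. Integrals and almost-everywhere statements are taken over \<open>leb T\<close>, so
  values outside $(0,T)$ and on null sets are irrelevant.
\<close>

abbreviation leb :: "real \<Rightarrow> real measure" where
  "leb T \<equiv> lebesgue_on {0<..<T}"

definition L1_norm :: "real \<Rightarrow> (real \<Rightarrow> real) \<Rightarrow> real" where
  "L1_norm T f = (LINT t|leb T. \<bar>f t\<bar>)"

definition L2 :: "real \<Rightarrow> (real \<Rightarrow> real) set" where
  "L2 T = {f. f \<in> borel_measurable (leb T) \<and> integrable (leb T) (\<lambda>t. (f t)\<^sup>2)}"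

definition L2_inner :: "real \<Rightarrow> (real \<Rightarrow> real) \<Rightarrow> (real \<Rightarrow> real) \<Rightarrow> real" where
  "L2_inner T f g = (LINT t|leb T. f t * g t)"

definition L2_norm :: "real \<Rightarrow> (real \<Rightarrow> real) \<Rightarrow> real" where
  "L2_norm T f = sqrt (L2_inner T f f)"

text \<open>A functional on $L^2(0,T)$ must not depend on the chosen representative.\<close>

definition L2_functional :: "real \<Rightarrow> ((real \<Rightarrow> real) \<Rightarrow> real) \<Rightarrow> bool" where
  "L2_functional T g \<longleftrightarrow>
     (\<forall>u\<in>L2 T. \<forall>v\<in>L2 T. (AE t in leb T. u t = v t) \<longrightarrow> g u = g v)"


section \<open>Frechet derivatives on $L^2(0,T)$\<close>

definition L2_linear :: "real \<Rightarrow> ((real \<Rightarrow> real) \<Rightarrow> real) \<Rightarrow> bool" where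
  "L2_linear T A \<longleftrightarrow>
     (\<forall>u\<in>L2 T. \<forall>v\<in>L2 T. A (\<lambda>t. u t + v t) = A u + A v) \<and>
     (\<forall>u\<in>L2 T. \<forall>c. A (\<lambda>t. c * u t) = c * A u)"

definition L2_bounded_linear :: "real \<Rightarrow> ((real \<Rightarrow> real) \<Rightarrow> real) \<Rightarrow> bool" where
  "L2_bounded_linear T A \<longleftrightarrow>
     L2_linear T A \<and> (\<exists>M. \<forall>u\<in>L2 T. \<bar>A u\<bar> \<le> M * L2_norm T u)"

definition L2_bounded_bilinear ::
  "real \<Rightarrow> ((real \<Rightarrow> real) \<Rightarrow> (real \<Rightarrow> real) \<Rightarrow> real) \<Rightarrow> bool" where
  "L2_bounded_bilinear T B \<longleftrightarrow>
     (\<forall>u\<in>L2 T. L2_linear T (B u)) \<and>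
     (\<forall>v\<in>L2 T. L2_linear T (\<lambda>u. B u v)) \<and>
     (\<exists>M. \<forall>u\<in>L2 T. \<forall>v\<in>L2 T. \<bar>B u v\<bar> \<le> M * L2_norm T u * L2_norm T v)"

definition has_L2_derivative ::
  "real \<Rightarrow> ((real \<Rightarrow> real) \<Rightarrow> real) \<Rightarrow> (real \<Rightarrow> real) \<Rightarrow> ((real \<Rightarrow> real) \<Rightarrow> real) \<Rightarrow> bool" where
  "has_L2_derivative T g w A \<longleftrightarrow>
     L2_bounded_linear T A \<and>
     (\<forall>e>0. \<exists>\<delta>>0. \<forall>h\<in>L2 T. L2_norm T h < \<delta> \<longrightarrow>
        \<bar>g (\<lambda>t. w t + h t) - g w - A h\<bar> \<le> e * L2_norm T h)"

text \<open>
  \<open>B\<close> is the Frechet derivative at \<open>w\<close> of the map \<open>u \<mapsto> Dg u\<close> from $L^2(0,T)$ into its dual,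
  with the dual norm of the remainder written out.
\<close>

definition has_L2_second_derivative ::
  "real \<Rightarrow> ((real \<Rightarrow> real) \<Rightarrow> (real \<Rightarrow> real) \<Rightarrow> real) \<Rightarrow> (real \<Rightarrow> real) \<Rightarrow>
     ((real \<Rightarrow> real) \<Rightarrow> (real \<Rightarrow> real) \<Rightarrow> real) \<Rightarrow> bool" where
  "has_L2_second_derivative T Dg w B \<longleftrightarrow>
     L2_bounded_bilinear T B \<and>
     (\<forall>e>0. \<exists>\<delta>>0. \<forall>h\<in>L2 T. L2_norm T h < \<delta> \<longrightarrow>
        (\<forall>v\<in>L2 T. \<bar>Dg (\<lambda>t. w t + h t) v - Dg w v - B h v\<bar> \<le> e * L2_norm T h * L2_norm T v))"

text \<open>The gradient is the Riesz representative of the Frechet derivative.\<close>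

definition has_L2_gradient ::
  "real \<Rightarrow> ((real \<Rightarrow> real) \<Rightarrow> real) \<Rightarrow> (real \<Rightarrow> real) \<Rightarrow> (real \<Rightarrow> real) \<Rightarrow> bool" where
  "has_L2_gradient T g w G \<longleftrightarrow> G \<in> L2 T \<and> has_L2_derivative T g w (L2_inner T G)"


section \<open>Functions of bounded variation\<close>

definition C1c :: "real \<Rightarrow> (real \<Rightarrow> real) set" where
  "C1c T = {\<phi>. \<phi> C1_differentiable_on UNIV \<and>
     compact (closure {t. \<phi> t \<noteq> 0}) \<and> closure {t. \<phi> t \<noteq> 0} \<subseteq> {0<..<T}}"

definition TV :: "real \<Rightarrow> (real \<Rightarrow> real) \<Rightarrow> ereal" where
  "TV T f = (SUP \<phi>\<in>{\<phi>\<in>C1c T. \<forall>t. \<bar>\<phi> t\<bar> \<le> 1}. ereal (LINT t|leb T. f t * deriv \<phi> t))"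

definition BV :: "real \<Rightarrow> (real \<Rightarrow> real) set" where
  "BV T = {f. integrable (leb T) f \<and> TV T f < \<infinity>}"

definition BVW :: "real \<Rightarrow> int set \<Rightarrow> (real \<Rightarrow> real) set" where
  "BVW T W = {w\<in>BV T. AE t in leb T. w t \<in> real_of_int ` W}"

definition weak_star_conv :: "real \<Rightarrow> (nat \<Rightarrow> real \<Rightarrow> real) \<Rightarrow> (real \<Rightarrow> real) \<Rightarrow> bool" where
  "weak_star_conv T u w \<longleftrightarrow>
     (\<forall>n. u n \<in> BV T) \<and> w \<in> BV T \<and>
     (\<lambda>n. L1_norm T (\<lambda>t. u n t - w t)) \<longlonglongrightarrow> 0 \<and>
     limsup (\<lambda>n. TV T (u n)) < \<infinity>"

definition strict_conv :: "real \<Rightarrow> (nat \<Rightarrow> real \<Rightarrow> real) \<Rightarrow> (real \<Rightarrow> real) \<Rightarrow> bool" where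
  "strict_conv T u w \<longleftrightarrow>
     weak_star_conv T u w \<and> (\<lambda>n. TV T (u n)) \<longlonglongrightarrow> TV T w"


section \<open>Mollification\<close>

definition mollifier_kernel :: "(real \<Rightarrow> real) \<Rightarrow> bool" where
  "mollifier_kernel \<eta> \<longleftrightarrow>
     (\<forall>n t. (deriv ^^ n) \<eta> field_differentiable (at t)) \<and>
     (\<forall>t. \<eta> t \<ge> 0) \<and>
     (LINT t|lebesgue. \<eta> t) = 1 \<and>
     closure {t. \<eta> t \<noteq> 0} \<subseteq> {-1..1}"

text \<open>
  The indicator extends \<open>w\<close> by zero. The restriction of the result to $[0,T]$ needs no separate
  encoding, since only values on $(0,T)$ matter for the class of the result in $L^2(0,T)$.
\<close>

definition mollify :: "(real \<Rightarrow> real) \<Rightarrow> real \<Rightarrow> real \<Rightarrow> (real \<Rightarrow> real) \<Rightarrow> real \<Rightarrow> real" where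
  "mollify \<eta> T \<epsilon> w t =
     (LINT s|lebesgue. (\<eta> ((t - s) / \<epsilon>) / \<epsilon>) * (indicator {0<..<T} s * w s))"


section \<open>The trust-region algorithm\<close>

text \<open>In the following, \<open>G w\<close> is the gradient of the objective at \<open>w\<close>.\<close>

definition tr_model ::
  "real \<Rightarrow> real \<Rightarrow> ((real \<Rightarrow> real) \<Rightarrow> real \<Rightarrow> real) \<Rightarrow> (real \<Rightarrow> real) \<Rightarrow> (real \<Rightarrow> real) \<Rightarrow> ereal" where
  "tr_model T \<alpha> G w d =
     ereal (L2_inner T (G w) d) + ereal \<alpha> * TV T (\<lambda>t. w t + d t) - ereal \<alpha> * TV T w"

definition tr_feasible ::
  "real \<Rightarrow> int set \<Rightarrow> (real \<Rightarrow> real) \<Rightarrow> real \<Rightarrow> (real \<Rightarrow> real) set" where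
  "tr_feasible T W w \<Delta> =
     {d\<in>L2 T. (AE s in leb T. w s + d s \<in> real_of_int ` W) \<and> L1_norm T d \<le> \<Delta>}"

definition tr_minimizer ::
  "real \<Rightarrow> real \<Rightarrow> int set \<Rightarrow> ((real \<Rightarrow> real) \<Rightarrow> real \<Rightarrow> real) \<Rightarrow>
     (real \<Rightarrow> real) \<Rightarrow> real \<Rightarrow> (real \<Rightarrow> real) \<Rightarrow> bool" where
  "tr_minimizer T \<alpha> W G w \<Delta> d \<longleftrightarrow>
     d \<in> tr_feasible T W w \<Delta> \<and>
     (\<forall>d'\<in>tr_feasible T W w \<Delta>. tr_model T \<alpha> G w d \<le> tr_model T \<alpha> G w d')"

definition pred_red ::
  "real \<Rightarrow> real \<Rightarrow> ((real \<Rightarrow> real) \<Rightarrow> real \<Rightarrow> real) \<Rightarrow> (real \<Rightarrow> real) \<Rightarrow> (real \<Rightarrow> real) \<Rightarrow> ereal" where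
  "pred_red T \<alpha> G w d = - tr_model T \<alpha> G w d"

definition actual_red ::
  "real \<Rightarrow> real \<Rightarrow> ((real \<Rightarrow> real) \<Rightarrow> real) \<Rightarrow> (real \<Rightarrow> real) \<Rightarrow> (real \<Rightarrow> real) \<Rightarrow> ereal" where
  "actual_red T \<alpha> g w d =
     ereal (g w) + ereal \<alpha> * TV T w
       - ereal (g (\<lambda>t. w t + d t)) - ereal \<alpha> * TV T (\<lambda>t. w t + d t)"

text \<open>
  \<open>tr_exec \<dots> w \<Delta> w'\<close>: from the iterate \<open>w\<close> and the current radius \<open>\<Delta>\<close> the algorithm can reach
  termination, after finitely many iterations, with final iterate \<open>w'\<close>. The relation is not
  functional because the minimizers need not be unique. \<open>\<Delta>min\<close> and \<open>pmin\<close> are the bounds of the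
  termination criteria on the radius and on the predicted reduction.
\<close>

inductive tr_exec ::
  "real \<Rightarrow> real \<Rightarrow> int set \<Rightarrow> real \<Rightarrow> real \<Rightarrow> real \<Rightarrow> real \<Rightarrow>
   ((real \<Rightarrow> real) \<Rightarrow> real) \<Rightarrow> ((real \<Rightarrow> real) \<Rightarrow> real \<Rightarrow> real) \<Rightarrow>
   (real \<Rightarrow> real) \<Rightarrow> real \<Rightarrow> (real \<Rightarrow> real) \<Rightarrow> bool"
  for T \<alpha> :: real and W :: "int set" and \<sigma> \<Delta>0 \<Delta>min pmin :: real
    and g :: "(real \<Rightarrow> real) \<Rightarrow> real" and G :: "(real \<Rightarrow> real) \<Rightarrow> real \<Rightarrow> real"
where
  stop_pred:
    "tr_exec T \<alpha> W \<sigma> \<Delta>0 \<Delta>min pmin g G w \<Delta> w"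
    if "tr_minimizer T \<alpha> W G w \<Delta> d"
       "pred_red T \<alpha> G w d < ereal pmin"
| stop_radius:
    "tr_exec T \<alpha> W \<sigma> \<Delta>0 \<Delta>min pmin g G w \<Delta> w"
    if "tr_minimizer T \<alpha> W G w \<Delta> d"
       "\<not> pred_red T \<alpha> G w d < ereal pmin"
       "actual_red T \<alpha> g w d / pred_red T \<alpha> G w d < ereal \<sigma>"
       "\<Delta> / 2 < \<Delta>min"
| reject:
    "tr_exec T \<alpha> W \<sigma> \<Delta>0 \<Delta>min pmin g G w \<Delta> w'"
    if "tr_minimizer T \<alpha> W G w \<Delta> d"
       "\<not> pred_red T \<alpha> G w d < ereal pmin"
       "actual_red T \<alpha> g w d / pred_red T \<alpha> G w d < ereal \<sigma>"
       "\<not> \<Delta> / 2 < \<Delta>min"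
       "tr_exec T \<alpha> W \<sigma> \<Delta>0 \<Delta>min pmin g G w (\<Delta> / 2) w'"
| accept:
    "tr_exec T \<alpha> W \<sigma> \<Delta>0 \<Delta>min pmin g G w \<Delta> w'"
    if "tr_minimizer T \<alpha> W G w \<Delta> d"
       "\<not> pred_red T \<alpha> G w d < ereal pmin"
       "\<not> actual_red T \<alpha> g w d / pred_red T \<alpha> G w d < ereal \<sigma>"
       "tr_exec T \<alpha> W \<sigma> \<Delta>0 \<Delta>min pmin g G (\<lambda>t. w t + d t) \<Delta>0 w'"

text \<open>
  The gradient map exists for every Frechet differentiable \<open>g\<close> (Riesz) and is unique up to null
  sets, so the existential quantifier only names it.
\<close>

definition tr_algorithm ::
  "real \<Rightarrow> real \<Rightarrow> int set \<Rightarrow> real \<Rightarrow> real \<Rightarrow> real \<Rightarrow> real \<Rightarrow>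
   ((real \<Rightarrow> real) \<Rightarrow> real) \<Rightarrow> (real \<Rightarrow> real) \<Rightarrow> (real \<Rightarrow> real) \<Rightarrow> bool" where
  "tr_algorithm T \<alpha> W \<sigma> \<Delta>0 \<Delta>min pmin g w0 w' \<longleftrightarrow>
     (\<exists>G. (\<forall>w\<in>L2 T. has_L2_gradient T g w (G w)) \<and>
        tr_exec T \<alpha> W \<sigma> \<Delta>0 \<Delta>min pmin g G w0 \<Delta>0 w')"

end

theory Submission
  imports Defs
begin

text \<open>
  Rejecting a step whose predicted reduction is at least \<open>p = (1 - 3 * a / 4) * \<alpha>\<close> forces the radius to
  exceed \<open>(1 - \<sigma>) * p / B\<close>, where \<open>B\<close> does not depend on \<open>\<epsilon>\<close>: mollification does not increase the
  $L^1$ norm, and for bounded functions the second-order remainder of \<open>j\<close> is controlled by that norm.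
  Hence for small \<open>\<epsilon>\<close> the radius criterion never fires, and the final radius stays above a fixed
  \<open>\<delta> > 0\<close>. If the final iterates converge to \<open>v\<close> in $L^1$, the step to \<open>v\<close> is eventually feasible, so
  the criterion on the predicted reduction bounds \<open>\<alpha> * (TV T (w n) - TV T v)\<close> by \<open>p + o(1) < \<alpha>\<close>. The
  total variation of an integer-valued function is an integer, thus \<open>TV T (w n) \<le> TV T v\<close> eventually,
  and lower semicontinuity yields strict convergence.

  Integrality and compactness both come from a pointwise description of the total variation: along a
  set of full measure on which mollifications converge, the variation over finite chains of points is
  at most \<open>TV\<close>, and if the function takes finitely many values, it is approximated in $L^1$ by its
  values on a grid with an error of at most the mesh size times the variation.
\<close>

section \<open>Mollification\<close>

text \<open>Two norms compete: radii are measured in L1, but \<open>j\<close> is smooth in L2. They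
  are reconciled by the finiteness of \<open>W\<close>: differences of \<open>W\<close>-valued
  functions are bounded by a constant \<open>2 * b\<close>, so the square of their L2 norm is at
  most \<open>2 * b\<close> times their L1 norm. The quadratic remainder thus becomes linear in the
  radius and loses against the fixed amount \<open>p\<close>; the first-order term only decays like
  the square root of the L1 distance, which still gives \<open>o(1)\<close>.

  \<open>TV\<close> is defined by duality and ignores null sets, so integrality cannot be read off
  from its definition. Chains turn it into a supremum of integers in a bounded range, which is
  attained. The two inequalities behind this are of different nature: chains are bounded by
  \<open>TV\<close> through mollified step functions as test functions, and \<open>TV\<close> is
  bounded by chains through step approximation of the function itself and summation by
  parts.\<close>

lemma finite_measure_leb: "finite_measure (leb T)"
  by (intro finite_measure_lebesgue_on) auto

lemma AE_leb_iff: "(AE t in leb T. P t) \<longleftrightarrow> (AE t in lebesgue. t \<in> {0<..<T} \<longrightarrow> P t)"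
  by (subst AE_restrict_space_iff) auto

lemma integral_leb: "(LINT t|leb T. (f t :: real)) = (LINT t|lebesgue. indicator {0<..<T} t * f t)"
  by (subst integral_restrict_space) auto

lemma integral_leb_borel:
  assumes [measurable]: "(f :: real \<Rightarrow> real) \<in> borel_measurable borel"
  shows "(LINT t|leb T. f t) = (LINT t|lborel. indicator {0<..<T} t * f t)"
  unfolding integral_leb by (rule integral_completion) measurable

lemma borel_measurable_lebI: "f \<in> borel_measurable borel \<Longrightarrow> f \<in> borel_measurable (leb T)"
  by (intro measurable_restrict_space1 measurable_completion) simp

lemma integrable_leb_bounded:
  assumes "(f :: real \<Rightarrow> real) \<in> borel_measurable (leb T)" "AE t in leb T. \<bar>f t\<bar> \<le> B"
  shows "integrable (leb T) f"
  by (rule finite_measure.integrable_const_bound[OF finite_measure_leb, where f = f and B = B]) (use assms in auto)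

text \<open>Fubini arguments ask for Borel functions, while classes on (0,T) are only Lebesgue
  measurable. A Borel function that agrees almost everywhere is clamped to [-B,B] and cut off, so
  that the bound holds everywhere and the extension by zero is built in.\<close>

lemma bounded_borel_representative:
  assumes f: "(f :: real \<Rightarrow> real) \<in> borel_measurable (leb T)"
    and B: "AE t in leb T. \<bar>f t\<bar> \<le> B" "0 \<le> B"
  obtains F where "F \<in> borel_measurable borel" "\<And>t. \<bar>F t\<bar> \<le> B"
    "\<And>t. t \<notin> {0<..<T} \<Longrightarrow> F t = 0" "AE t in leb T. f t = F t"
proof -
  have "(\<lambda>t. indicator {0<..<T} t * f t) \<in> borel_measurable lebesgue"
    using f by (subst (asm) borel_measurable_restrict_space_iff) auto
  then obtain g where g: "g \<in> borel_measurable lborel" "AE t in lebesgue. indicator {0<..<T} t * f t = g t"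
    using completion_ex_borel_measurable_real[of "\<lambda>t. indicator {0<..<T} t * f t" lborel] AE_completion by blast
  define F where "F t = indicator {0<..<T} t * max (-B) (min B (g t))" for t :: real
  have "F \<in> borel_measurable borel"
    using g(1) unfolding F_def by measurable
  moreover have "\<bar>F t\<bar> \<le> B" for t
    using B(2) by (auto simp: F_def indicator_def)
  moreover have "F t = 0" if "t \<notin> {0<..<T}" for t
    using that by (simp add: F_def)
  moreover have "AE t in leb T. f t = F t"
    using g(2) B(1) unfolding AE_leb_iff
    by eventually_elim (auto simp: F_def indicator_def split: if_splits)
  ultimately show ?thesis by (rule that)
qed


section \<open>Convolution with a rescaled kernel\<close>

locale mollifier =
  fixes \<eta> :: "real \<Rightarrow> real"
  assumes kernel: "mollifier_kernel \<eta>"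
begin

lemma kernel_differentiable: "\<eta> field_differentiable (at t)"
  using kernel unfolding mollifier_kernel_def by (metis funpow_0)

lemma kernel_continuous: "continuous_on UNIV \<eta>"
  using kernel_differentiable
  by (simp add: continuous_on_eq_continuous_at field_differentiable_imp_continuous_at)

lemma kernel_measurable [measurable]: "\<eta> \<in> borel_measurable borel"
  by (rule borel_measurable_continuous_onI[OF kernel_continuous])

lemma kernel_nonneg: "\<eta> t \<ge> 0"
  using kernel unfolding mollifier_kernel_def by simp

lemma kernel_eq_0: "\<eta> t = 0" if "t \<notin> {-1..1}"
proof -
  have "closure {t. \<eta> t \<noteq> 0} \<subseteq> {-1..1}"
    using kernel unfolding mollifier_kernel_def by simp
  then have "{t. \<eta> t \<noteq> 0} \<subseteq> {-1..1}"
    by (rule order.trans[OF closure_subset])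
  then show ?thesis using that by blast
qed

lemma kernel_integral: "(LINT t|lborel. \<eta> t) = 1"
  using kernel unfolding mollifier_kernel_def by (simp add: integral_completion)

text \<open>A non-integrable function has integral 0 by convention, so the value 1 already forces
  integrability.\<close>

lemma kernel_integrable: "integrable lborel \<eta>"
  using kernel_integral not_integrable_integral_eq by fastforce

lemma kernel_has_bochner_integral: "has_bochner_integral lborel \<eta> 1"
  using kernel_integral kernel_integrable by (simp add: has_bochner_integral_iff)

definition rho :: "real \<Rightarrow> real \<Rightarrow> real" where
  "rho h x = \<eta> (x / h) / h"

lemma rho_measurable [measurable]: "rho h \<in> borel_measurable borel"
  unfolding rho_def[abs_def] by measurable

lemma rho_nonneg: "h > 0 \<Longrightarrow> rho h x \<ge> 0"
  unfolding rho_def by (simp add: kernel_nonneg)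

lemma rho_mass_left:
  assumes "h > 0"
  shows "has_bochner_integral lborel (\<lambda>t. rho h (t - s)) 1"
proof -
  have "has_bochner_integral lborel (\<lambda>t. \<eta> (- s / h + (1 / h) * t)) (1 /\<^sub>R \<bar>1 / h\<bar>)"
    using lborel_has_bochner_integral_real_affine_iff[of "1 / h" \<eta> 1 "- s / h"] 
      kernel_has_bochner_integral assms by simp
  moreover have "- s / h + (1 / h) * t = (t - s) / h" for t
    using assms by (simp add: field_simps)
  ultimately have "has_bochner_integral lborel (\<lambda>t. \<eta> ((t - s) / h)) h"
    using assms by simp
  then show ?thesis
    unfolding rho_def using has_bochner_integral_divide[of lborel _ h h] assms by simp
qed

lemma rho_mass_right:
  assumes "h > 0"
  shows "has_bochner_integral lborel (\<lambda>s. rho h (t - s)) 1"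
proof -
  have "has_bochner_integral lborel (\<lambda>s. \<eta> (t / h + (- 1 / h) * s)) (1 /\<^sub>R \<bar>- 1 / h\<bar>)"
    using lborel_has_bochner_integral_real_affine_iff[of "- 1 / h" \<eta> 1 "t / h"] 
      kernel_has_bochner_integral assms by simp
  moreover have "t / h + (- 1 / h) * s = (t - s) / h" for s
    using assms by (simp add: field_simps)
  ultimately have "has_bochner_integral lborel (\<lambda>s. \<eta> ((t - s) / h)) h"
    using assms by simp
  then show ?thesis
    unfolding rho_def using has_bochner_integral_divide[of lborel _ h h] assms by simp
qed

text \<open>Convolution on the whole line, taken over \<open>lborel\<close> so that Fubini is
  available. \<open>mollify\<close> reduces to it once a Borel representative vanishing off the
  interval is chosen.\<close>

definition conv :: "real \<Rightarrow> (real \<Rightarrow> real) \<Rightarrow> real \<Rightarrow> real" where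
  "conv h F t = (LINT s|lborel. rho h (t - s) * F s)"

lemma conv_measurable [measurable]:
  assumes [measurable]: "F \<in> borel_measurable borel"
  shows "conv h F \<in> borel_measurable borel"
proof -
  have "(\<lambda>t. LINT s|lborel. rho h (t - s) * F s) \<in> borel_measurable borel"
    by measurable
  then show ?thesis unfolding conv_def[abs_def] .
qed

lemma conv_integrand:
  assumes F [measurable]: "F \<in> borel_measurable borel" and B: "\<And>t. \<bar>F t\<bar> \<le> B" and "h > 0"
  shows "integrable lborel (\<lambda>s. rho h (t - s) * F s)"
proof (rule Bochner_Integration.integrable_bound)
  show "integrable lborel (\<lambda>s. rho h (t - s) * B)"
    using rho_mass_right[OF \<open>h > 0\<close>, of t] by (simp add: has_bochner_integral_iff)
  show "(\<lambda>s. rho h (t - s) * F s) \<in> borel_measurable lborel"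
    by measurable
  have "0 \<le> B" using B[of 0] by simp
  then show "AE s in lborel. norm (rho h (t - s) * F s) \<le> norm (rho h (t - s) * B)"
    using B rho_nonneg[OF \<open>h > 0\<close>] by (auto simp: abs_mult intro!: mult_mono)
qed

lemma conv_bounded:
  assumes F [measurable]: "F \<in> borel_measurable borel" and B: "\<And>t. \<bar>F t\<bar> \<le> B" and "h > 0"
  shows "\<bar>conv h F t\<bar> \<le> B"
proof -
  have "\<bar>conv h F t\<bar> \<le> (LINT s|lborel. \<bar>rho h (t - s) * F s\<bar>)"
    unfolding conv_def using integral_abs_bound by blast
  also have "\<dots> \<le> (LINT s|lborel. rho h (t - s) * B)"
    using B rho_nonneg[OF \<open>h > 0\<close>] integrable_abs[OF conv_integrand[OF F B \<open>h > 0\<close>, of t]] rho_mass_right[OF \<open>h > 0\<close>, of t]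
    by (intro integral_mono) (auto simp: has_bochner_integral_iff abs_mult intro!: mult_mono)
  also have "\<dots> = B"
    using rho_mass_right[OF \<open>h > 0\<close>, of t] by (simp add: has_bochner_integral_iff)
  finally show ?thesis .
qed

lemma conv_diff:
  assumes F: "F \<in> borel_measurable borel" "\<And>t. \<bar>F t\<bar> \<le> B"
    and G: "G \<in> borel_measurable borel" "\<And>t. \<bar>G t\<bar> \<le> B'" and "h > 0"
  shows "conv h (\<lambda>s. F s - G s) t = conv h F t - conv h G t"
  unfolding conv_def
  using conv_integrand[OF F \<open>h > 0\<close>, of t] conv_integrand[OF G \<open>h > 0\<close>, of t]
  by (simp add: right_diff_distrib)

text \<open>Tonelli: integrating in \<open>t\<close> first leaves the mass 1 of the kernel for every
  \<open>s\<close>. This is Young's inequality, with a constant that does not see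
  \<open>h\<close>.\<close>

lemma conv_L1:
  assumes F [measurable]: "F \<in> borel_measurable borel" and i: "integrable lborel F" and "h > 0"
  shows "integrable lborel (conv h F)" "(LINT t|lborel. \<bar>conv h F t\<bar>) \<le> (LINT t|lborel. \<bar>F t\<bar>)"
proof -
  have le: "ennreal \<bar>conv h F t\<bar> \<le> (\<integral>\<^sup>+s. ennreal (rho h (t - s)) * ennreal \<bar>F s\<bar> \<partial>lborel)" for t
  proof (cases "integrable lborel (\<lambda>s. rho h (t - s) * F s)")
    case True
    have "ennreal \<bar>conv h F t\<bar> \<le> (\<integral>\<^sup>+s. norm (rho h (t - s) * F s) \<partial>lborel)"
      unfolding conv_def using integral_norm_bound_ennreal[OF True] by simp
    also have "\<dots> = (\<integral>\<^sup>+s. ennreal (rho h (t - s)) * ennreal \<bar>F s\<bar> \<partial>lborel)"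
      using rho_nonneg[OF \<open>h > 0\<close>] by (intro nn_integral_cong) (simp add: abs_mult ennreal_mult)
    finally show ?thesis .
  next
    case False
    \<comment> \<open>The integral defaults to 0 where the integrand is not integrable, so the bound
      is trivial at such \<open>t\<close>.\<close>
    then show ?thesis by (simp add: conv_def not_integrable_integral_eq)
  qed
  have k1: "(\<integral>\<^sup>+t. ennreal (rho h (t - s)) \<partial>lborel) = 1" for s
    using rho_mass_left[OF \<open>h > 0\<close>, of s] rho_nonneg[OF \<open>h > 0\<close>]
    by (subst nn_integral_eq_integral) (auto simp: has_bochner_integral_iff)
  have "(\<integral>\<^sup>+t. ennreal \<bar>conv h F t\<bar> \<partial>lborel)
      \<le> (\<integral>\<^sup>+t. (\<integral>\<^sup>+s. ennreal (rho h (t - s)) * ennreal \<bar>F s\<bar> \<partial>lborel) \<partial>lborel)"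
    using le by (intro nn_integral_mono) auto
  also have "\<dots> = (\<integral>\<^sup>+s. (\<integral>\<^sup>+t. ennreal (rho h (t - s)) * ennreal \<bar>F s\<bar> \<partial>lborel) \<partial>lborel)"
    by (rule lborel_pair.Fubini') measurable
  also have "\<dots> = (\<integral>\<^sup>+s. ennreal \<bar>F s\<bar> \<partial>lborel)"
    by (subst nn_integral_multc) (use k1 in auto)
  also have "\<dots> = ennreal (LINT t|lborel. \<bar>F t\<bar>)"
    using i by (intro nn_integral_eq_integral) auto
  finally have *: "(\<integral>\<^sup>+t. ennreal \<bar>conv h F t\<bar> \<partial>lborel) \<le> ennreal (LINT t|lborel. \<bar>F t\<bar>)" .
  then show I: "integrable lborel (conv h F)"
    by (intro integrableI_bounded) (auto simp: order.strict_trans1)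
  have "ennreal (LINT t|lborel. \<bar>conv h F t\<bar>) = (\<integral>\<^sup>+t. ennreal \<bar>conv h F t\<bar> \<partial>lborel)"
    using I by (intro nn_integral_eq_integral[symmetric]) auto
  with * show "(LINT t|lborel. \<bar>conv h F t\<bar>) \<le> (LINT t|lborel. \<bar>F t\<bar>)"
    by (metis ennreal_le_iff integral_nonneg_AE abs_ge_zero AE_I2)
qed

lemma mollify_eq_conv:
  assumes f: "f \<in> borel_measurable (leb T)" and F [measurable]: "F \<in> borel_measurable borel"
    and F0: "\<And>t. t \<notin> {0<..<T} \<Longrightarrow> F t = 0" and eq: "AE t in leb T. f t = F t"
  shows "mollify \<eta> T h f = conv h F"
proof
  fix t
  have [measurable]: "(\<lambda>s. indicator {0<..<T} s * f s) \<in> borel_measurable lebesgue"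
    using f by (subst (asm) borel_measurable_restrict_space_iff) auto
  have m: "(\<lambda>s. rho h (t - s)) \<in> borel_measurable lebesgue"
    by (rule measurable_completion) measurable
  have "mollify \<eta> T h f t = (LINT s|lebesgue. rho h (t - s) * F s)"
    unfolding mollify_def rho_def[symmetric]
  proof (rule integral_cong_AE)
    show "(\<lambda>s. rho h (t - s) * (indicator {0<..<T} s * f s)) \<in> borel_measurable lebesgue"
      using m by measurable
    show "(\<lambda>s. rho h (t - s) * F s) \<in> borel_measurable lebesgue"
      by (rule measurable_completion) measurable
    show "AE s in lebesgue. rho h (t - s) * (indicator {0<..<T} s * f s) = rho h (t - s) * F s"
      using eq[unfolded AE_leb_iff] by eventually_elim (use F0 in \<open>auto simp: indicator_def\<close>)
  qed
  also have "\<dots> = conv h F t"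
    unfolding conv_def by (rule integral_completion) measurable
  finally show "mollify \<eta> T h f t = conv h F t" .
qed


text \<open>Extending to the line costs nothing, since the representative vanishes outside the
  interval, and restricting back can only lose mass. Neither bound depends on \<open>h\<close>; all
  later uniformity in \<open>\<epsilon>\<close> comes from here.\<close>

lemma mollify_L1_bound:
  assumes f: "f \<in> borel_measurable (leb T)" and B: "AE t in leb T. \<bar>f t\<bar> \<le> B" "0 \<le> B" and "h > 0"
  shows "mollify \<eta> T h f \<in> borel_measurable borel" "\<bar>mollify \<eta> T h f t\<bar> \<le> B"
    "L1_norm T (mollify \<eta> T h f) \<le> L1_norm T f"
proof -
  obtain F where F: "F \<in> borel_measurable borel" "\<And>t. \<bar>F t\<bar> \<le> B"
    "\<And>t. t \<notin> {0<..<T} \<Longrightarrow> F t = 0" "AE t in leb T. f t = F t"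
    using bounded_borel_representative[OF f B] by metis
  note [measurable] = F(1)
  have eq: "mollify \<eta> T h f = conv h F"
    using mollify_eq_conv[OF f F(1,3,4)] .
  show "mollify \<eta> T h f \<in> borel_measurable borel" "\<bar>mollify \<eta> T h f t\<bar> \<le> B"
    unfolding eq using conv_bounded[OF F(1,2) \<open>h > 0\<close>] by auto
  have F0: "F t = indicator {0<..<T} t * F t" for t
    using F(3)[of t] by (cases "t \<in> {0<..<T}") auto
  have "integrable (leb T) F"
    using F(2) borel_measurable_lebI[OF F(1)] by (intro integrable_leb_bounded[of _ _ B]) auto
  then have "integrable lebesgue F"
    by (subst (asm) integrable_restrict_space) (auto simp: F0[symmetric])
  then have F1: "integrable lborel F"
    using integrable_completion[of F lborel] F(1) by simp
  have i: "integrable lborel (\<lambda>t. \<bar>conv h F t\<bar>)"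
    using conv_L1(1)[OF F(1) F1 \<open>h > 0\<close>] by simp
  have "L1_norm T (conv h F) = (LINT t|lborel. indicator {0<..<T} t * \<bar>conv h F t\<bar>)"
    unfolding L1_norm_def by (rule integral_leb_borel) measurable
  also have "\<dots> \<le> (LINT t|lborel. \<bar>conv h F t\<bar>)"
  proof (rule integral_mono)
    show "integrable lborel (\<lambda>t. indicator {0<..<T} t * \<bar>conv h F t\<bar>)"
      using integrable_mult_indicator[OF _ i, of "{0<..<T}"] by simp
  qed (use i in \<open>auto simp: indicator_def\<close>)
  also have "\<dots> \<le> (LINT t|lborel. \<bar>F t\<bar>)"
    by (rule conv_L1(2)[OF F(1) F1 \<open>h > 0\<close>])
  also have "\<dots> = (LINT t|lborel. indicator {0<..<T} t * \<bar>F t\<bar>)"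
    using F(3) by (intro Bochner_Integration.integral_cong) (auto simp: indicator_def)
  also have "\<dots> = (LINT t|leb T. \<bar>F t\<bar>)"
    by (rule integral_leb_borel[symmetric]) measurable
  also have "\<dots> = L1_norm T f"
    unfolding L1_norm_def using f F(4) borel_measurable_lebI[OF F(1)]
    by (intro integral_cong_AE) auto
  finally show "L1_norm T (mollify \<eta> T h f) \<le> L1_norm T f"
    unfolding eq .
qed

text \<open>Both sides are integrals against the same kernel, so they agree at every point and not
  just almost everywhere. Hence \<open>j\<close> after mollification, taken along a line, is
  literally \<open>j\<close> along the mollified line.\<close>

lemma mollify_affine:
  assumes f: "f \<in> borel_measurable (leb T)" "AE t in leb T. \<bar>f t\<bar> \<le> B" "0 \<le> B"
    and g: "g \<in> borel_measurable (leb T)" "AE t in leb T. \<bar>g t\<bar> \<le> B'" "0 \<le> B'" and "h > 0"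
  shows "mollify \<eta> T h (\<lambda>t. f t + c * g t) = (\<lambda>t. mollify \<eta> T h f t + c * mollify \<eta> T h g t)"
proof -
  obtain F where F: "F \<in> borel_measurable borel" "\<And>t. \<bar>F t\<bar> \<le> B"
    "\<And>t. t \<notin> {0<..<T} \<Longrightarrow> F t = 0" "AE t in leb T. f t = F t"
    using bounded_borel_representative[OF f] by metis
  obtain G where G: "G \<in> borel_measurable borel" "\<And>t. \<bar>G t\<bar> \<le> B'"
    "\<And>t. t \<notin> {0<..<T} \<Longrightarrow> G t = 0" "AE t in leb T. g t = G t"
    using bounded_borel_representative[OF g] by metis
  have "mollify \<eta> T h (\<lambda>t. f t + c * g t) = conv h (\<lambda>t. F t + c * G t)"
  proof (rule mollify_eq_conv)
    show "AE t in leb T. f t + c * g t = F t + c * G t"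
      using F(4) G(4) by eventually_elim simp
  qed (use f(1) g(1) F(1,3) G(1,3) in auto)
  moreover have "conv h (\<lambda>t. F t + c * G t) t = conv h F t + c * conv h G t" for t
    unfolding conv_def
    using conv_integrand[OF F(1,2) \<open>h > 0\<close>, of t] conv_integrand[OF G(1,2) \<open>h > 0\<close>, of t]
    by (simp add: distrib_left mult.left_commute[of _ c])
  ultimately show ?thesis
    using mollify_eq_conv[OF f(1) F(1,3,4)] mollify_eq_conv[OF g(1) G(1,3,4)] by (simp add: fun_eq_iff)
qed

text \<open>The kernel averages over the window of radius \<open>h\<close> with total weight 1, so a
  bound on the deviation within the window survives the averaging.\<close>

lemma conv_local:
  assumes "h > 0" and c [measurable]: "c \<in> borel_measurable borel" and B: "\<And>s. \<bar>c s\<bar> \<le> B"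
    and e: "\<And>s. \<bar>s - t\<bar> \<le> h \<Longrightarrow> \<bar>c s - x\<bar> \<le> e"
  shows "\<bar>conv h c t - x\<bar> \<le> e"
proof -
  have k: "integrable lborel (\<lambda>s. rho h (t - s))" "(LINT s|lborel. rho h (t - s)) = 1"
    using rho_mass_right[OF \<open>h > 0\<close>, of t] by (auto simp: has_bochner_integral_iff)
  have i: "integrable lborel (\<lambda>s. rho h (t - s) * c s)"
    by (rule conv_integrand[OF c B \<open>h > 0\<close>])
  have "conv h c t - x = (LINT s|lborel. rho h (t - s) * c s - rho h (t - s) * x)"
    unfolding conv_def using i k by simp
  then have "\<bar>conv h c t - x\<bar> \<le> (LINT s|lborel. \<bar>rho h (t - s) * c s - rho h (t - s) * x\<bar>)"
    using integral_abs_bound by metis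
  also have "\<dots> \<le> (LINT s|lborel. rho h (t - s) * e)"
  proof (rule integral_mono)
    show "integrable lborel (\<lambda>s. \<bar>rho h (t - s) * c s - rho h (t - s) * x\<bar>)"
      "integrable lborel (\<lambda>s. rho h (t - s) * e)"
      using i k by auto
    fix s
    have "rho h (t - s) = 0" if "\<not> \<bar>s - t\<bar> \<le> h"
      using that \<open>h > 0\<close> kernel_eq_0[of "(t - s) / h"] by (auto simp: rho_def field_simps abs_le_iff)
    then show "\<bar>rho h (t - s) * c s - rho h (t - s) * x\<bar> \<le> rho h (t - s) * e"
      using rho_nonneg[OF \<open>h > 0\<close>, of "t - s"] e[of s]
      by (cases "\<bar>s - t\<bar> \<le> h") (auto simp: abs_mult right_diff_distrib[symmetric] mult_left_mono)
  qed
  also have "\<dots> = e" using k by simp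
  finally show ?thesis .
qed

end

text \<open>A Lebesgue measurable function is a limit of continuous ones off a negligible set.
  Clamping these to [-B,B] preserves continuity and limit and supplies the dominating function on a
  bounded interval.\<close>

lemma continuous_approximation_L1:
  assumes F: "F \<in> borel_measurable borel" and B: "\<And>t. \<bar>F t\<bar> \<le> B" and "e > 0"
  obtains c :: "real \<Rightarrow> real" where "continuous_on UNIV c" "\<And>t. \<bar>c t\<bar> \<le> B"
    "(LINT t|lborel. indicator {a..b} t * \<bar>F t - c t\<bar>) < e"
proof -
  have B0: "0 \<le> B" using B[of 0] by simp
  have "F \<in> borel_measurable lebesgue"
    using F by (intro measurable_completion) simp
  then have "F measurable_on UNIV"
    by (simp add: measurable_on_iff_borel_measurable)
  then obtain N g where N: "negligible N" and g: "\<And>n. continuous_on UNIV (g n)"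
    and lim: "\<And>x. x \<notin> N \<Longrightarrow> (\<lambda>n. g n x) \<longlonglongrightarrow> F x"
    unfolding measurable_on_def by auto
  define c where "c n t = max (-B) (min B (g n t))" for n :: nat and t :: real
  have c: "continuous_on UNIV (c n)" for n
    unfolding c_def[abs_def] by (intro continuous_intros g)
  have cB: "\<bar>c n t\<bar> \<le> B" for n t
    using B0 by (auto simp: c_def)
  have [measurable]: "c n \<in> borel_measurable borel" for n
    by (rule borel_measurable_continuous_onI[OF c])
  note [measurable] = F
  have "(\<lambda>n. LINT t|lborel. indicator {a..b} t * \<bar>F t - c n t\<bar>) \<longlonglongrightarrow> (LINT t|(lborel::real measure). 0)"
  proof (rule integral_dominated_convergence)
    show "integrable lborel (\<lambda>t::real. indicator {a..b} t * (2 * B))"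
      by (intro integrable_mult_left integrable_real_indicator) (auto simp: emeasure_lborel_Icc_eq)
    have "AE t in lebesgue. t \<notin> N"
      using N by (simp add: AE_not_in negligible_iff_null_sets)
    then have "AE t in lebesgue. (\<lambda>n. indicator {a..b} t * \<bar>F t - c n t\<bar>) \<longlonglongrightarrow> 0"
    proof eventually_elim
      case (elim t)
      have "(\<lambda>n. c n t) \<longlonglongrightarrow> max (-B) (min B (F t))"
        unfolding c_def by (intro tendsto_intros lim elim)
      moreover have "max (-B) (min B (F t)) = F t"
        using B[of t] by auto
      ultimately have "(\<lambda>n. indicator {a..b} t * \<bar>F t - c n t\<bar>) \<longlonglongrightarrow> indicator {a..b} t * \<bar>F t - F t\<bar>"
        by (intro tendsto_intros) auto
      then show ?case by simp
    qed
    then show "AE t in lborel. (\<lambda>n. indicator {a..b} t * \<bar>F t - c n t\<bar>) \<longlonglongrightarrow> 0"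
      by (simp only: AE_completion_iff) 
    show "AE t in lborel. norm (indicator {a..b} t * \<bar>F t - c n t\<bar>) \<le> indicator {a..b} t * (2 * B)" for n
    proof (rule AE_I2)
      fix t
      have "\<bar>F t - c n t\<bar> \<le> 2 * B"
        using B[of t] cB[of n t] by linarith
      then show "norm (indicator {a..b} t * \<bar>F t - c n t\<bar>) \<le> indicator {a..b} t * (2 * B)"
        by (simp add: indicator_def)
    qed
  qed auto
  then have "eventually (\<lambda>n. (LINT t|lborel. indicator {a..b} t * \<bar>F t - c n t\<bar>) < e) sequentially"
    using \<open>e > 0\<close> by (intro order_tendstoD) auto
  then obtain n where "(LINT t|lborel. indicator {a..b} t * \<bar>F t - c n t\<bar>) < e"
    using eventually_happens' sequentially_bot by blast
  with c cB that show ?thesis by blast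
qed

context mollifier
begin

text \<open>\<open>F\<close> is split into a truncated continuous function, which mollification
  moves uniformly little, and a remainder \<open>D\<close> with small L1 norm, which mollification
  does not enlarge.\<close>

lemma mollify_L1_tendsto:
  assumes f: "f \<in> borel_measurable (leb T)" and B: "AE t in leb T. \<bar>f t\<bar> \<le> B" "0 \<le> B"
    and "T > 0" and h: "\<And>n. h n > 0" "h \<longlonglongrightarrow> 0"
  shows "(\<lambda>n. L1_norm T (\<lambda>t. mollify \<eta> T (h n) f t - f t)) \<longlonglongrightarrow> 0"
proof -
  obtain F where F: "F \<in> borel_measurable borel" "\<And>t. \<bar>F t\<bar> \<le> B"
    "\<And>t. t \<notin> {0<..<T} \<Longrightarrow> F t = 0" "AE t in leb T. f t = F t"
    using bounded_borel_representative[OF f B] by metis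
  note [measurable] = F(1)
  have eq: "L1_norm T (\<lambda>t. mollify \<eta> T (h n) f t - f t) = (LINT t|lborel. indicator {0<..<T} t * \<bar>conv (h n) F t - F t\<bar>)" for n
  proof -
    have m: "(\<lambda>t. \<bar>conv (h n) F t - F t\<bar>) \<in> borel_measurable borel" by measurable
    have [measurable]: "conv (h n) F \<in> borel_measurable (leb T)" "f \<in> borel_measurable (leb T)"
      by (simp_all add: borel_measurable_lebI f)
    have ae: "AE t in leb T. \<bar>conv (h n) F t - f t\<bar> = \<bar>conv (h n) F t - F t\<bar>"
      using F(4) by eventually_elim simp
    have "mollify \<eta> T (h n) f = conv (h n) F"
      by (rule mollify_eq_conv[OF f F(1) _ F(4)]) (rule F(3))
    then have "L1_norm T (\<lambda>t. mollify \<eta> T (h n) f t - f t) = (LINT t|leb T. \<bar>conv (h n) F t - F t\<bar>)"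
      unfolding L1_norm_def
      by (simp only:) (rule integral_cong_AE[OF _ borel_measurable_lebI[OF m] ae], measurable)
    then show ?thesis using integral_leb_borel[OF m] by simp
  qed
  have "\<exists>n0. \<forall>n\<ge>n0. (LINT t|lborel. indicator {0<..<T} t * \<bar>conv (h n) F t - F t\<bar>) < e" if "e > 0" for e
  proof -
    \<comment> \<open>Two L1 errors below \<open>e'\<close> from \<open>D\<close>, and a uniform
      error \<open>e'\<close> on an interval of length \<open>T\<close>, must add up to at most
      \<open>e\<close>.\<close>
    define e' where "e' = e / (3 + T)"
    have e': "e' > 0" using \<open>e > 0\<close> \<open>T > 0\<close> by (simp add: e'_def)
    \<comment> \<open>One unit of room on each side keeps the window around a point of (0,T) inside
      \<open>I\<close> once \<open>h n < 1\<close>.\<close>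
    define I where "I = {-1..T+1}"
    obtain c where c: "continuous_on UNIV c" "\<And>t. \<bar>c t\<bar> \<le> B"
      and cF: "(LINT t|lborel. indicator I t * \<bar>F t - c t\<bar>) < e'"
      using continuous_approximation_L1[OF F(1,2) e'] unfolding I_def by metis
    have [measurable]: "c \<in> borel_measurable borel" "I \<in> sets borel"
      by (auto simp: I_def intro: borel_measurable_continuous_onI[OF c(1)])
    \<comment> \<open>Outside \<open>I\<close> the function \<open>F\<close> vanishes. Cutting
      \<open>c\<close> off there makes the L1 error on \<open>I\<close> an error on the whole line,
      as \<open>conv_L1\<close> requires for \<open>D\<close>.\<close>
    define c' where "c' t = indicator I t * c t" for t
    define D where "D t = F t - c' t" for t
    have [measurable]: "c' \<in> borel_measurable borel" "D \<in> borel_measurable borel"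
      unfolding c'_def[abs_def] D_def[abs_def] by measurable
    have c'B: "\<bar>c' t\<bar> \<le> B" for t
      using c(2)[of t] B(2) by (simp add: c'_def indicator_def)
    have D: "\<bar>D t\<bar> = indicator I t * \<bar>F t - c t\<bar>" for t
      using F(3)[of t] \<open>T > 0\<close> by (auto simp: D_def c'_def I_def indicator_def)
    have D_int: "integrable lborel D"
    proof (rule Bochner_Integration.integrable_bound)
      show "integrable lborel (\<lambda>t. indicator I t * (2 * B))"
        unfolding I_def by (intro integrable_mult_left integrable_real_indicator) (auto simp: emeasure_lborel_Icc_eq)
      show "AE t in lborel. norm (D t) \<le> norm (indicator I t * (2 * B))"
      proof (rule AE_I2)
        fix t
        have "\<bar>F t - c t\<bar> \<le> 2 * B"
          using F(2)[of t] c(2)[of t] by linarith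
        then show "norm (D t) \<le> norm (indicator I t * (2 * B))"
          using B(2) unfolding real_norm_def D by (simp add: indicator_def)
      qed
    qed simp
    have "uniformly_continuous_on I c"
      unfolding I_def by (intro compact_uniformly_continuous continuous_on_subset[OF c(1)]) auto
    then obtain \<delta> where \<delta>: "\<delta> > 0" "\<And>s t. s \<in> I \<Longrightarrow> t \<in> I \<Longrightarrow> \<bar>s - t\<bar> < \<delta> \<Longrightarrow> \<bar>c s - c t\<bar> < e'"
      unfolding uniformly_continuous_on_def dist_real_def using e' by metis
    have "eventually (\<lambda>n. h n < min \<delta> 1) sequentially"
      using \<delta>(1) h(2) by (intro order_tendstoD) auto
    then obtain n0 where n0: "\<And>n. n \<ge> n0 \<Longrightarrow> h n < min \<delta> 1"
      by (auto simp: eventually_sequentially)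
    have "(LINT t|lborel. indicator {0<..<T} t * \<bar>conv (h n) F t - F t\<bar>) < e" if "n \<ge> n0" for n
    proof -
      have hn: "h n < \<delta>" "h n < 1" using n0[OF that] by auto
      have pw: "indicator {0<..<T} t * \<bar>conv (h n) F t - F t\<bar>
          \<le> \<bar>conv (h n) D t\<bar> + indicator {0<..<T} t * e' + \<bar>D t\<bar>" for t
      proof (cases "t \<in> {0<..<T}")
        case True
        have "conv (h n) D t = conv (h n) F t - conv (h n) c' t"
          unfolding D_def[abs_def] using F(1,2) c'B h(1) by (intro conv_diff) auto
        moreover have "\<bar>conv (h n) c' t - c t\<bar> \<le> e'"
        proof (rule conv_local[OF h(1) _ c'B])
          fix s assume s: "\<bar>s - t\<bar> \<le> h n"
          have "s \<in> I" "t \<in> I"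
            using True s hn \<open>T > 0\<close> unfolding I_def greaterThanLessThan_iff atLeastAtMost_iff by linarith+
          then show "\<bar>c' s - c t\<bar> \<le> e'"
            using \<delta>(2)[of s t] s hn by (auto simp: c'_def intro: less_imp_le)
        qed simp
        moreover have "\<bar>D t\<bar> = \<bar>F t - c t\<bar>"
          using True by (simp add: D I_def)
        ultimately show ?thesis using True by simp
      qed auto
      have i1: "integrable lborel (conv (h n) D)"
        by (rule conv_L1(1)[OF _ D_int h(1)]) simp
      have i2: "integrable lborel (\<lambda>t. indicator {0<..<T} t * e' :: real)"
        by (intro integrable_mult_left integrable_real_indicator) (use \<open>T > 0\<close> in auto)
      have "(LINT t|lborel. indicator {0<..<T} t * \<bar>conv (h n) F t - F t\<bar>)
          \<le> (LINT t|lborel. \<bar>conv (h n) D t\<bar> + indicator {0<..<T} t * e' + \<bar>D t\<bar>)"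
      proof (rule integral_mono)
        show i3: "integrable lborel (\<lambda>t. \<bar>conv (h n) D t\<bar> + indicator {0<..<T} t * e' + \<bar>D t\<bar>)"
          using i1 i2 D_int by auto
        show "integrable lborel (\<lambda>t. indicator {0<..<T} t * \<bar>conv (h n) F t - F t\<bar>)"
          by (rule Bochner_Integration.integrable_bound[OF i3])
            (use pw e' in \<open>auto simp: abs_mult intro!: AE_I2 order.trans[OF pw]\<close>)
      qed (rule pw)
      also have "\<dots> = (LINT t|lborel. \<bar>conv (h n) D t\<bar>) + T * e' + (LINT t|lborel. \<bar>D t\<bar>)"
        using i1 i2 D_int \<open>T > 0\<close> by simp
      also have "\<dots> \<le> (LINT t|lborel. \<bar>D t\<bar>) + T * e' + (LINT t|lborel. \<bar>D t\<bar>)"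
        using conv_L1(2)[OF _ D_int h(1)] by simp
      also have "\<dots> < (2 + T) * e'"
        using cF unfolding D by (simp add: algebra_simps)
      also have "\<dots> \<le> e"
        using \<open>T > 0\<close> \<open>e > 0\<close> by (simp add: e'_def field_simps)
      finally show ?thesis .
    qed
    then show ?thesis by blast
  qed
  moreover have "0 \<le> (LINT t|lborel. indicator {0<..<T} t * \<bar>conv (h n) F t - F t\<bar>)" for n
    by (intro integral_nonneg_AE AE_I2) auto
  ultimately show ?thesis
    unfolding eq LIMSEQ_iff by simp
qed

end


section \<open>Total variation as a supremum over finite chains\<close>

lemma C1c_deriv:
  assumes "\<phi> \<in> C1c T"
  shows "(\<phi> has_real_derivative deriv \<phi> t) (at t)" "continuous_on UNIV (deriv \<phi>)"
proof -
  obtain D where D: "\<And>x. (\<phi> has_vector_derivative D x) (at x)" "continuous_on UNIV D"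
    using assms unfolding C1c_def C1_differentiable_on_def by auto
  then have d: "(\<phi> has_real_derivative D x) (at x)" for x
    by (simp add: has_real_derivative_iff_has_vector_derivative)
  then have "deriv \<phi> = D"
    by (simp add: fun_eq_iff DERIV_imp_deriv)
  with d D show "(\<phi> has_real_derivative deriv \<phi> t) (at t)" "continuous_on UNIV (deriv \<phi>)"
    by auto
qed

lemma C1c_eq_0:
  assumes "\<phi> \<in> C1c T" "t \<notin> {0<..<T}"
  shows "\<phi> t = 0"
proof -
  have "closure {t. \<phi> t \<noteq> 0} \<subseteq> {0<..<T}"
    using assms unfolding C1c_def by simp
  then have "{t. \<phi> t \<noteq> 0} \<subseteq> {0<..<T}"
    by (rule order.trans[OF closure_subset])
  then show ?thesis using assms(2) by blast
qed

lemma C1c_deriv_bounded: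
  assumes "\<phi> \<in> C1c T"
  obtains L where "0 \<le> L" "\<And>t. t \<in> {0<..<T} \<Longrightarrow> \<bar>deriv \<phi> t\<bar> \<le> L"
proof -
  have "bounded (deriv \<phi> ` {0..T})"
    by (intro compact_imp_bounded compact_continuous_image continuous_on_subset[OF C1c_deriv(2)[OF assms]]) auto
  then obtain L where "\<And>t. t \<in> {0..T} \<Longrightarrow> \<bar>deriv \<phi> t\<bar> \<le> L"
    unfolding bounded_iff by (metis imageI real_norm_def)
  then show ?thesis by (intro that[of "max 0 L"]) (auto simp: le_max_iff_disj)
qed

lemma C1c_deriv_measurable:
  assumes "\<phi> \<in> C1c T"
  shows "deriv \<phi> \<in> borel_measurable (leb T)"
  by (intro borel_measurable_lebI borel_measurable_continuous_onI C1c_deriv(2)[OF assms])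

lemma TV_ge:
  assumes "\<phi> \<in> C1c T" "\<And>t. \<bar>\<phi> t\<bar> \<le> 1"
  shows "ereal (LINT t|leb T. f t * deriv \<phi> t) \<le> TV T f"
  unfolding TV_def using assms by (intro SUP_upper) auto

lemma TV_le:
  assumes "\<And>\<phi>. \<phi> \<in> C1c T \<Longrightarrow> (\<And>t. \<bar>\<phi> t\<bar> \<le> 1) \<Longrightarrow> ereal (LINT t|leb T. f t * deriv \<phi> t) \<le> V"
  shows "TV T f \<le> V"
  unfolding TV_def using assms by (intro SUP_least) auto

lemma TV_nonneg: "0 \<le> TV T f"
proof -
  have "(\<lambda>_. 0) \<in> C1c T" by (simp add: C1c_def)
  from TV_ge[OF this, of f] show ?thesis by (simp add: zero_ereal_def)
qed

text \<open>\<open>E\<close> is a smoothed Heaviside function. Differences of its shifts are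
  mollified indicators of intervals, the building blocks of the test function that detects the
  variation.\<close>

lemma (in mollifier) kernel_antiderivative:
  obtains E where "\<And>x. (E has_real_derivative \<eta> x) (at x)" "\<And>x. x \<le> -1 \<Longrightarrow> E x = 0"
    "\<And>x. 1 \<le> x \<Longrightarrow> E x = 1" "mono E"
proof -
  have "\<exists>F. \<forall>x :: real. (-\<infinity> :: ereal) < ereal x \<longrightarrow> ereal x < \<infinity> \<longrightarrow> (F has_vector_derivative \<eta> x) (at x)"
    using kernel_continuous
    by (intro einterval_antiderivative) (auto simp: continuous_on_eq_continuous_at)
  then obtain F where F: "\<And>x. (F has_real_derivative \<eta> x) (at x)"
    by (auto simp: has_real_derivative_iff_has_vector_derivative)
  define E where "E x = F x - F (-1)" for x
  have E: "(E has_real_derivative \<eta> x) (at x)" for x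
    unfolding E_def[abs_def] by (auto intro!: derivative_eq_intros F)
  have mono: "mono E"
    using E kernel_nonneg by (intro monoI) (metis DERIV_nonneg_imp_nondecreasing)
  have const: "E y = E x" if "x \<le> y" "\<And>z. x < z \<Longrightarrow> z < y \<Longrightarrow> z \<notin> {-1..1}" for x y
  proof (cases "x = y")
    case False
    then have "x < y" using that by simp
    moreover have "continuous_on {x..y} E"
      using E by (meson DERIV_isCont continuous_at_imp_continuous_on)
    moreover have "(E has_real_derivative 0) (at z)" if "x < z" "z < y" for z
      using E[of z] kernel_eq_0[of z] \<open>\<And>z. x < z \<Longrightarrow> z < y \<Longrightarrow> z \<notin> {-1..1}\<close> that by simp
    ultimately show ?thesis
      by (intro DERIV_isconst_end) auto
  qed simp
  have m1: "E x = 0" if "x \<le> -1" for x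
    using const[of x "-1"] that by (auto simp: E_def)
  have "(\<eta> has_integral (E 1 - E (-1))) {-1..1}"
    using E by (intro fundamental_theorem_of_calculus)
      (auto simp: has_real_derivative_iff_has_vector_derivative[symmetric] intro: DERIV_subset)
  then have "(\<eta> has_integral (E 1 - E (-1))) UNIV"
    by (rule has_integral_on_superset) (use kernel_eq_0 in auto)
  moreover have "(\<eta> has_integral 1) UNIV"
    using has_integral_integral_lborel[OF kernel_integrable] kernel_integral by simp
  ultimately have "E 1 - E (-1) = 1"
    by (rule has_integral_unique)
  then have "E 1 = 1"
    using m1[of "-1"] by simp
  then have p1: "E x = 1" if "1 \<le> x" for x
    using const[of 1 x] that by auto
  from that E m1 p1 mono show ?thesis by blast
qed

text \<open>Up to sign, the test function is the mollification of the step function that takes the sign of the \<open>i\<close>-th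
  increment between \<open>t i\<close> and \<open>t (Suc i)\<close>.\<close>

lemma (in mollifier) mollify_variation_le_TV:
  assumes f: "f \<in> borel_measurable (leb T)" and B: "AE t in leb T. \<bar>f t\<bar> \<le> B" "0 \<le> B" and "h > 0"
    and t: "\<And>i. i < m \<Longrightarrow> t i \<le> t (Suc i)" "h < t 0" "t m + h < T"
  shows "ereal (\<Sum>i<m. \<bar>mollify \<eta> T h f (t (Suc i)) - mollify \<eta> T h f (t i)\<bar>) \<le> TV T f"
proof -
  obtain E where E: "\<And>x. (E has_real_derivative \<eta> x) (at x)" "\<And>x. x \<le> -1 \<Longrightarrow> E x = 0"
    "\<And>x. 1 \<le> x \<Longrightarrow> E x = 1" "mono E"
    using kernel_antiderivative by blast
  define K where "K = mollify \<eta> T h f"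
  define \<sigma> where "\<sigma> i = sgn (K (t (Suc i)) - K (t i))" for i
  \<comment> \<open>As a function of \<open>s\<close>, \<open>E ((x - s) / h)\<close> has derivative
    \<open>- rho h (x - s)\<close>. The leading minus sign makes \<open>f\<close> integrated against
    the derivative of \<open>\<phi>\<close> the sum of the increments of \<open>K\<close> weighted
    by their signs.\<close>
  define \<phi> where "\<phi> s = - (\<Sum>i<m. \<sigma> i * (E ((t (Suc i) - s) / h) - E ((t i - s) / h)))" for s
  define D where "D s = (\<Sum>i<m. \<sigma> i * (rho h (t (Suc i) - s) - rho h (t i - s)))" for s
  have t_mono: "t i \<le> t k" if "i \<le> k" "k \<le> m" for i k
    using that
  proof (induction k rule: dec_induct)
    case (step n)
    then show ?case using t(1)[of n] by simp
  qed simp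
  have d: "(\<phi> has_real_derivative D s) (at s)" for s
  proof -
    have "((\<lambda>s. E ((x - s) / h)) has_real_derivative \<eta> ((x - s) / h) * (- 1 / h)) (at s)" for x
      by (rule DERIV_chain2[OF E(1)]) (use \<open>h > 0\<close> in \<open>auto intro!: derivative_eq_intros simp: field_simps\<close>)
    then have dE: "((\<lambda>s. E ((x - s) / h)) has_real_derivative - rho h (x - s)) (at s)" for x
      by (simp add: rho_def)
    have "(\<phi> has_real_derivative - (\<Sum>i<m. \<sigma> i * (- rho h (t (Suc i) - s) - - rho h (t i - s)))) (at s)"
      unfolding \<phi>_def[abs_def] by (intro DERIV_minus DERIV_sum DERIV_cmult DERIV_diff dE)
    moreover have "- (\<Sum>i<m. \<sigma> i * (- rho h (t (Suc i) - s) - - rho h (t i - s))) = D s"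
      unfolding D_def sum_negf[symmetric] by (intro sum.cong) (auto simp: algebra_simps)
    ultimately show ?thesis by simp
  qed
  then have dD: "deriv \<phi> = D"
    by (simp add: fun_eq_iff DERIV_imp_deriv)
  have "continuous_on UNIV (rho h)"
    unfolding rho_def[abs_def]
    using \<open>h > 0\<close> by (auto intro!: continuous_on_divide continuous_on_compose2[OF kernel_continuous] continuous_on_id)
  then have Dc: "continuous_on UNIV D"
    unfolding D_def[abs_def]
    by (auto intro!: continuous_on_sum continuous_on_mult continuous_on_diff continuous_on_compose2[of UNIV "rho h"] continuous_on_const continuous_on_id)
  \<comment> \<open>Smoothing widens the support by \<open>h\<close> on both sides, for which
    \<open>h < t 0\<close> and \<open>t m + h < T\<close> leave room.\<close>
  have "\<phi> s = 0" if "s \<notin> {t 0 - h..t m + h}" for s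
  proof -
    have "E ((t (Suc i) - s) / h) - E ((t i - s) / h) = 0" if "i < m" for i
    proof (cases "s < t 0 - h")
      case True
      then have "1 \<le> (t (Suc i) - s) / h" "1 \<le> (t i - s) / h"
        using t_mono[of 0 "Suc i"] t_mono[of 0 i] that \<open>h > 0\<close> by (simp_all add: field_simps)
      then show ?thesis using E(3) by simp
    next
      case False
      then have "s > t m + h" using \<open>s \<notin> _\<close> by auto
      then have "(t (Suc i) - s) / h \<le> -1" "(t i - s) / h \<le> -1"
        using t_mono[of "Suc i" m] t_mono[of i m] that \<open>h > 0\<close> by (simp_all add: field_simps)
      then show ?thesis using E(2) by simp
    qed
    then show ?thesis unfolding \<phi>_def by simp
  qed
  then have "{s. \<phi> s \<noteq> 0} \<subseteq> {t 0 - h..t m + h}" by blast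
  then have cl: "closure {s. \<phi> s \<noteq> 0} \<subseteq> {t 0 - h..t m + h}"
    by (rule closure_minimal) simp
  then have "compact (closure {s. \<phi> s \<noteq> 0})"
    by (meson bounded_closed_interval bounded_subset closed_closure compact_eq_bounded_closed)
  moreover have "{t 0 - h..t m + h} \<subseteq> {0<..<T}"
    using t by auto
  moreover have "\<phi> C1_differentiable_on UNIV"
    unfolding C1_differentiable_on_def using d Dc
    by (auto simp: has_real_derivative_iff_has_vector_derivative)
  ultimately have \<phi>: "\<phi> \<in> C1c T"
    using cl unfolding C1c_def by auto
  have "\<bar>\<phi> s\<bar> \<le> 1" for s
  proof -
    have "\<bar>\<phi> s\<bar> \<le> (\<Sum>i<m. \<bar>\<sigma> i * (E ((t (Suc i) - s) / h) - E ((t i - s) / h))\<bar>)"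
      unfolding \<phi>_def by simp
    \<comment> \<open>\<open>E\<close> is monotone and the chain is ordered, so after dropping the
      signs the sum telescopes to a difference of two values in [0,1].\<close>
    also have "\<dots> \<le> (\<Sum>i<m. E ((t (Suc i) - s) / h) - E ((t i - s) / h))"
    proof (rule sum_mono)
      fix i assume "i \<in> {..<m}"
      then have "E ((t i - s) / h) \<le> E ((t (Suc i) - s) / h)"
        using t(1)[of i] \<open>h > 0\<close> by (intro monoD[OF E(4)] divide_right_mono) auto
      then show "\<bar>\<sigma> i * (E ((t (Suc i) - s) / h) - E ((t i - s) / h))\<bar> \<le> E ((t (Suc i) - s) / h) - E ((t i - s) / h)"
        by (auto simp: \<sigma>_def sgn_if abs_mult)
    qed
    also have "\<dots> = E ((t m - s) / h) - E ((t 0 - s) / h)"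
      by (rule sum_lessThan_telescope)
    also have "\<dots> \<le> 1"
    proof -
      have "E x \<le> 1" for x
        using monoD[OF E(4), of x "max x 1"] E(3)[of "max x 1"] by simp
      moreover have "0 \<le> E x" for x
        using monoD[OF E(4), of "min x (-1)" x] E(2)[of "min x (-1)"] by simp
      ultimately show ?thesis by (smt (verit))
    qed
    finally show ?thesis .
  qed
  then have "ereal (LINT s|leb T. f s * D s) \<le> TV T f"
    using TV_ge[OF \<phi>, of f] by (simp add: dD)
  moreover have "(LINT s|leb T. f s * D s) = (\<Sum>i<m. \<bar>K (t (Suc i)) - K (t i)\<bar>)"
  proof -
    have rb: "\<exists>M. \<forall>s\<in>{0<..<T}. \<bar>rho h (x - s)\<bar> \<le> M" for x
    proof -
      have "continuous_on {0..T} (\<lambda>s. rho h (x - s))"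
        by (rule continuous_on_compose2[OF \<open>continuous_on UNIV (rho h)\<close>])
          (auto intro!: continuous_on_diff continuous_on_const continuous_on_id)
      then have "bounded ((\<lambda>s. rho h (x - s)) ` {0..T})"
        by (intro compact_imp_bounded compact_continuous_image) auto
      then obtain M where "\<forall>s\<in>{0..T}. \<bar>rho h (x - s)\<bar> \<le> M"
        by (auto simp: bounded_iff)
      then show ?thesis by (intro exI[of _ M]) simp
    qed
    have i: "integrable (leb T) (\<lambda>s. f s * rho h (x - s))" for x
    proof -
      obtain M where M: "\<forall>s\<in>{0<..<T}. \<bar>rho h (x - s)\<bar> \<le> M" using rb by blast
      have "AE s in leb T. s \<in> {0<..<T}" by (auto simp: AE_leb_iff)
      with B(1) have "AE s in leb T. \<bar>f s * rho h (x - s)\<bar> \<le> B * M"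
        by eventually_elim (use M B(2) in \<open>auto simp: abs_mult intro!: mult_mono\<close>)
      moreover have "(\<lambda>s. rho h (x - s)) \<in> borel_measurable (leb T)"
        by (rule borel_measurable_lebI) measurable
      ultimately show ?thesis
        using f by (intro integrable_leb_bounded) auto
    qed
    have K: "K x = (LINT s|leb T. f s * rho h (x - s))" for x
      unfolding K_def mollify_def integral_leb rho_def
      by (intro Bochner_Integration.integral_cong) auto
    have "(LINT s|leb T. f s * D s)
        = (LINT s|leb T. (\<Sum>i<m. \<sigma> i * (f s * rho h (t (Suc i) - s) - f s * rho h (t i - s))))"
      unfolding D_def by (simp add: sum_distrib_left algebra_simps)
    also have "\<dots> = (\<Sum>i<m. \<sigma> i * (K (t (Suc i)) - K (t i)))"
      unfolding K using i by simp
    also have "\<dots> = (\<Sum>i<m. \<bar>K (t (Suc i)) - K (t i)\<bar>)"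
      by (simp add: \<sigma>_def abs_sgn mult.commute)
    finally show ?thesis .
  qed
  ultimately show ?thesis unfolding K_def by simp
qed

text \<open>Values on null sets are arbitrary, so chains are confined to a set \<open>G\<close>,
  which is later one of full measure. Points may repeat, which spares case distinctions when chains
  are assembled from two families of points.\<close>

definition variation_le :: "real set \<Rightarrow> (real \<Rightarrow> real) \<Rightarrow> ereal \<Rightarrow> bool" where
  "variation_le G f V \<longleftrightarrow>
     (\<forall>m t. (\<forall>i<m. t i \<le> t (Suc i)) \<longrightarrow> (\<forall>i\<le>m. t i \<in> G) \<longrightarrow>
        ereal (\<Sum>i<m. \<bar>f (t (Suc i)) - f (t i)\<bar>) \<le> V)"

lemma variation_leD:
  assumes "variation_le G f V" "\<And>i. i < m \<Longrightarrow> t i \<le> t (Suc i)" "\<And>i. i \<le> m \<Longrightarrow> t i \<in> G"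
  shows "ereal (\<Sum>i<m. \<bar>f (t (Suc i)) - f (t i)\<bar>) \<le> V"
  using assms unfolding variation_le_def by blast

lemma variation_le_subset: "variation_le G f V \<Longrightarrow> H \<subseteq> G \<Longrightarrow> variation_le H f V"
  unfolding variation_le_def by blast

text \<open>Convergence in L1 gives convergence almost everywhere along a subsequence of scales, and
  \<open>G\<close> is the set where it takes place. On a fixed finite chain in \<open>G\<close>, the
  bound for the mollified functions passes to the limit.\<close>

lemma (in mollifier) ex_variation_le_TV:
  assumes f: "f \<in> borel_measurable (leb T)" and B: "AE t in leb T. \<bar>f t\<bar> \<le> B" "0 \<le> B" and "T > 0"
  shows "\<exists>G\<subseteq>{0<..<T}. (AE t in leb T. t \<in> G) \<and> variation_le G f (TV T f)"
proof -
  define h where "h n = 1 / real (Suc n)" for n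
  have h: "h n > 0" for n by (simp add: h_def)
  have h0: "h \<longlonglongrightarrow> 0"
    unfolding h_def[abs_def] by (rule LIMSEQ_Suc[OF lim_1_over_n])
  have m: "mollify \<eta> T (h n) f \<in> borel_measurable (leb T)" "\<bar>mollify \<eta> T (h n) f t\<bar> \<le> B" for n t
    using mollify_L1_bound(2)[OF f B h] borel_measurable_lebI[OF mollify_L1_bound(1)[OF f B h]] by auto
  have "integrable (leb T) (\<lambda>t. mollify \<eta> T (h n) f t - f t)" for n
    using m f B by (intro Bochner_Integration.integrable_diff integrable_leb_bounded) auto
  then obtain r where r: "strict_mono r"
    and ae: "AE t in leb T. (\<lambda>n. mollify \<eta> T (h (r n)) f t - f t) \<longlonglongrightarrow> 0"
    using tendsto_L1_AE_subseq[of "leb T" "\<lambda>n t. mollify \<eta> T (h n) f t - f t"]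
      mollify_L1_tendsto[OF f B \<open>T > 0\<close> h h0] unfolding L1_norm_def by auto
  define G where "G = {t \<in> {0<..<T}. (\<lambda>n. mollify \<eta> T (h (r n)) f t - f t) \<longlonglongrightarrow> 0}"
  have lim: "(\<lambda>n. mollify \<eta> T (h (r n)) f t) \<longlonglongrightarrow> f t" if "t \<in> G" for t
    using that unfolding G_def by (simp add: LIM_zero_cancel)
  have "variation_le G f (TV T f)"
    unfolding variation_le_def
  proof (intro allI impI)
    fix m :: nat and t :: "nat \<Rightarrow> real"
    assume t: "\<forall>i<m. t i \<le> t (Suc i)" "\<forall>i\<le>m. t i \<in> G"
    \<comment> \<open>A finite chain in the open interval keeps a positive distance from both ends,
      so all small scales are admissible for it.\<close>
    have pos: "0 < t 0" "t m < T" using t(2) by (auto simp: G_def)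
    have "(\<lambda>n. \<Sum>i<m. \<bar>mollify \<eta> T (h (r n)) f (t (Suc i)) - mollify \<eta> T (h (r n)) f (t i)\<bar>)
        \<longlonglongrightarrow> (\<Sum>i<m. \<bar>f (t (Suc i)) - f (t i)\<bar>)"
      using t(2) by (intro tendsto_intros lim) auto
    moreover have "eventually (\<lambda>n. ereal (\<Sum>i<m. \<bar>mollify \<eta> T (h (r n)) f (t (Suc i)) - mollify \<eta> T (h (r n)) f (t i)\<bar>) \<le> TV T f) sequentially"
    proof -
      have "(\<lambda>n. h (r n)) \<longlonglongrightarrow> 0"
        using LIMSEQ_subseq_LIMSEQ[OF h0 r] by (simp add: o_def)
      then have "eventually (\<lambda>n. h (r n) < min (t 0) (T - t m)) sequentially"
        using pos by (intro order_tendstoD) auto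
      then show ?thesis
        by eventually_elim (use t(1) in \<open>intro mollify_variation_le_TV[OF f B h], auto\<close>)
    qed
    ultimately show "ereal (\<Sum>i<m. \<bar>f (t (Suc i)) - f (t i)\<bar>) \<le> TV T f"
      by (intro tendsto_upperbound[of "\<lambda>n. ereal (\<Sum>i<m. \<bar>mollify \<eta> T (h (r n)) f (t (Suc i)) - mollify \<eta> T (h (r n)) f (t i)\<bar>)"]) auto
  qed
  moreover have "AE t in leb T. t \<in> G"
    using ae unfolding AE_leb_iff G_def by eventually_elim auto
  ultimately show ?thesis
    by (intro exI[of _ G]) (auto simp: G_def)
qed

section \<open>Uniform grids and step functions\<close>

definition cell :: "real \<Rightarrow> nat \<Rightarrow> nat \<Rightarrow> real set" where
  "cell T N i = {real i * (T / real N)<..<real (Suc i) * (T / real N)}"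

definition step :: "real \<Rightarrow> nat \<Rightarrow> (real \<Rightarrow> real) \<Rightarrow> (nat \<Rightarrow> real) \<Rightarrow> real \<Rightarrow> real" where
  "step T N f p t = (\<Sum>i<N. indicator (cell T N i) t * f (p i))"

lemma cell_subset: "T > 0 \<Longrightarrow> i < N \<Longrightarrow> cell T N i \<subseteq> {0<..<T}"
proof
  fix t assume "T > 0" "i < N" "t \<in> cell T N i"
  then have "real (Suc i) * (T / real N) \<le> real N * (T / real N)"
    by (intro mult_right_mono) auto
  moreover have "0 \<le> real i * (T / real N)"
    using \<open>T > 0\<close> by simp
  ultimately show "t \<in> {0<..<T}"
    using \<open>t \<in> cell T N i\<close> \<open>i < N\<close> unfolding cell_def by auto
qed

lemma cell_disjoint:
  assumes "t \<in> cell T N i" "t \<in> cell T N k" "T > 0"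
  shows "i = k"
proof -
  have N: "0 < T / real N"
  proof (cases "N = 0")
    case True
    then show ?thesis using assms(1) by (simp add: cell_def)
  qed (use \<open>T > 0\<close> in simp)
  have "real i * (T / real N) < real (Suc k) * (T / real N)" "real k * (T / real N) < real (Suc i) * (T / real N)"
    using assms by (auto simp: cell_def)
  then have "real i < real (Suc k)" "real k < real (Suc i)"
    using N by (simp_all only: mult_less_cancel_right_pos)
  then show ?thesis by simp
qed

lemma step_cell:
  assumes "t \<in> cell T N i" "i < N" "T > 0"
  shows "step T N f p t = f (p i)"
proof -
  have "indicator (cell T N k) t = (if k = i then 1 else 0 :: real)" for k
  proof (cases "k = i")
    case False
    then have "t \<notin> cell T N k" using cell_disjoint[OF assms(1) _ assms(3)] by blast
    with False show ?thesis by simp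
  qed (use assms(1) in simp)
  then have "step T N f p t = (\<Sum>k<N. if k = i then f (p k) else 0)"
    unfolding step_def by (intro sum.cong) auto
  then show ?thesis using assms(2) by simp
qed

lemma AE_cell:
  assumes "T > 0" "N > 0"
  shows "AE t in leb T. \<exists>i<N. t \<in> cell T N i"
proof -
  have "negligible ((\<lambda>i. real i * (T / real N)) ` {..N})"
    by (intro negligible_finite) auto
  then have "AE t in lebesgue. t \<notin> (\<lambda>i. real i * (T / real N)) ` {..N}"
    by (simp add: AE_not_in negligible_iff_null_sets)
  then show ?thesis unfolding AE_leb_iff
  proof eventually_elim
    case (elim t)
    show ?case
    proof
      assume t: "t \<in> {0<..<T}"
      define \<delta> where "\<delta> = T / real N"
      have \<delta>: "\<delta> > 0" "real N * \<delta> = T" using assms by (auto simp: \<delta>_def)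
      define i where "i = nat \<lfloor>t / \<delta>\<rfloor>"
      have "0 \<le> t / \<delta>" using t \<delta> by simp
      then have "real i \<le> t / \<delta>" "t / \<delta> < real (Suc i)"
        unfolding i_def by linarith+
      then have i: "real i * \<delta> \<le> t" "t < real (Suc i) * \<delta>"
        using \<delta>(1) by (simp_all add: field_simps)
      have "real i * \<delta> < real N * \<delta>" using i(1) t \<delta>(2) by simp
      then have "i < N" using \<delta>(1) by simp
      moreover have "t \<noteq> real i * \<delta>"
        using elim \<open>i < N\<close> unfolding \<delta>_def by auto
      ultimately show "\<exists>i<N. t \<in> cell T N i"
        using i unfolding cell_def \<delta>_def by (intro exI[of _ i]) auto
    qed
  qed
qed

lemma full_measure_meets_interval:
  assumes "AE t in leb T. t \<in> G" "0 \<le> a" "a < b" "b \<le> T"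
  obtains p where "p \<in> G" "a < p" "p < b"
proof (rule ccontr)
  assume "\<not> thesis"
  with that have no: "\<And>p. p \<in> G \<Longrightarrow> \<not> (a < p \<and> p < b)" by blast
  have "AE t in lebesgue. t \<notin> {a<..<b}"
    using assms(1) unfolding AE_leb_iff
    by eventually_elim (use no assms in force)
  then have "{a<..<b} \<in> null_sets lebesgue"
    by (subst (asm) AE_iff_null_sets[symmetric]) auto
  then show False using \<open>a < b\<close> by (auto simp: null_sets_def)
qed

lemma full_measure_meets_cell:
  assumes "T > 0" and G: "AE t in leb T. t \<in> G" and "i < N"
  shows "\<exists>p. p \<in> G \<inter> cell T N i"
proof -
  have "real (Suc i) * (T / real N) \<le> real N * (T / real N)"
    using assms by (intro mult_right_mono) auto
  moreover have "real i * (T / real N) < real (Suc i) * (T / real N)"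
    using assms by (intro mult_strict_right_mono) auto
  ultimately show ?thesis
    using full_measure_meets_interval[OF G, of "real i * (T / real N)" "real (Suc i) * (T / real N)"] assms
    by (auto simp: cell_def)
qed

lemma integral_leb_cell:
  assumes "T > 0" "i < N"
  shows "(LINT t|leb T. indicator (cell T N i) t) = T / real N"
    "integrable (leb T) (indicator (cell T N i) :: real \<Rightarrow> real)"
proof -
  have sub: "cell T N i \<subseteq> {0<..<T}" by (rule cell_subset[OF assms])
  have [measurable]: "cell T N i \<in> sets borel" by (simp add: cell_def)
  have "(indicator (cell T N i) :: real \<Rightarrow> real) \<in> borel_measurable borel"
    by measurable
  then have "(LINT t|leb T. indicator (cell T N i) t :: real) = (LINT t|lborel. indicator {0<..<T} t * indicator (cell T N i) t)"
    by (rule integral_leb_borel)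
  also have "\<dots> = (LINT t|lborel. indicator (cell T N i) t)"
    using sub by (intro Bochner_Integration.integral_cong) (auto simp: indicator_def)
  also have "\<dots> = T / real N"
  proof -
    have "real i * (T / real N) \<le> real (Suc i) * (T / real N)"
      using \<open>T > 0\<close> by (intro mult_right_mono) auto
    then have "measure lborel (cell T N i) = real (Suc i) * (T / real N) - real i * (T / real N)"
      unfolding cell_def by (rule measure_lborel_Ioo)
    then show ?thesis by (simp add: algebra_simps add_divide_distrib)
  qed
  finally show "(LINT t|leb T. indicator (cell T N i) t) = T / real N" .
  show "integrable (leb T) (indicator (cell T N i) :: real \<Rightarrow> real)"
    by (rule integrable_leb_bounded[of _ _ 1]) (auto intro!: borel_measurable_lebI simp: indicator_def)
qed

lemma step_measurable [measurable]: "step T N f p \<in> borel_measurable (leb T)"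
  unfolding step_def[abs_def] cell_def by (intro borel_measurable_lebI) measurable

text \<open>Since \<open>f\<close> takes finitely many values, its deviation from \<open>f (p i)\<close> on the \<open>i\<close>-th cell is
  attained at some point; these points together with the \<open>p i\<close> form a chain, so that the
  deviations sum up to at most the variation.\<close>

lemma step_approximation:
  assumes "T > 0" "N > 0" "finite (f ` G)" and G: "AE t in leb T. t \<in> G"
    and f: "f \<in> borel_measurable (leb T)"
    and p: "\<And>i. i < N \<Longrightarrow> p i \<in> G \<inter> cell T N i" and V: "variation_le G f (ereal V)"
  shows "integrable (leb T) (\<lambda>t. \<bar>f t - step T N f p t\<bar>)"
    "(LINT t|leb T. \<bar>f t - step T N f p t\<bar>) \<le> T / real N * V"
proof -
  have "\<exists>q. q \<in> G \<inter> cell T N i \<and> (\<forall>s\<in>G \<inter> cell T N i. \<bar>f s - f (p i)\<bar> \<le> \<bar>f q - f (p i)\<bar>)" if "i < N" for i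
  proof -
    let ?A = "(\<lambda>s. \<bar>f s - f (p i)\<bar>) ` (G \<inter> cell T N i)"
    have "?A \<subseteq> (\<lambda>y. \<bar>y - f (p i)\<bar>) ` (f ` G)" by auto
    then have fin: "finite ?A" using assms(3) by (meson finite_imageI finite_subset)
    have "Max ?A \<in> ?A" using fin p[OF that] by (intro Max_in) auto
    then obtain q where q: "q \<in> G \<inter> cell T N i" "Max ?A = \<bar>f q - f (p i)\<bar>" by auto
    have "\<bar>f s - f (p i)\<bar> \<le> \<bar>f q - f (p i)\<bar>" if "s \<in> G \<inter> cell T N i" for s
      using Max_ge[OF fin, of "\<bar>f s - f (p i)\<bar>"] that q(2) by auto
    with q(1) show ?thesis by blast
  qed
  then obtain q where q: "\<And>i. i < N \<Longrightarrow> q i \<in> G \<inter> cell T N i"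
    "\<And>i s. i < N \<Longrightarrow> s \<in> G \<inter> cell T N i \<Longrightarrow> \<bar>f s - f (p i)\<bar> \<le> \<bar>f (q i) - f (p i)\<bar>"
    by metis
  have q_sum: "(\<Sum>i<N. \<bar>f (q i) - f (p i)\<bar>) \<le> V"
  proof -
    \<comment> \<open>Each cell contributes the smaller and then the larger of \<open>p i\<close>
      and \<open>q i\<close>, in all \<open>2 * N\<close> points and hence \<open>2 * N - 1\<close>
      increments. The increments at even indices are the deviations; those at odd indices bridge
      neighbouring cells and are dropped.\<close>
    define \<tau> where "\<tau> j = (if even j then min (p (j div 2)) (q (j div 2)) else max (p (j div 2)) (q (j div 2)))" for j
    define m where "m = 2 * N - 1"
    have m: "Suc m = 2 * N" using \<open>N > 0\<close> by (simp add: m_def)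
    have "\<tau> j \<in> G" if "j \<le> m" for j
    proof -
      have "j div 2 < N" using that m by auto
      then show ?thesis using p q(1) by (auto simp: \<tau>_def min_def max_def)
    qed
    moreover have "\<tau> j \<le> \<tau> (Suc j)" if "j < m" for j
    proof (cases "even j")
      case True
      then show ?thesis by (auto simp: \<tau>_def)
    next
      case False
      then obtain i where i: "j = 2 * i + 1" by (auto elim: oddE)
      then have "Suc i < N" using that m by auto
      then have "p i \<in> cell T N i" "q i \<in> cell T N i" "p (Suc i) \<in> cell T N (Suc i)" "q (Suc i) \<in> cell T N (Suc i)"
        using p q(1) by auto
      then show ?thesis using i by (auto simp: \<tau>_def cell_def)
    qed
    ultimately have "(\<Sum>j<m. \<bar>f (\<tau> (Suc j)) - f (\<tau> j)\<bar>) \<le> V"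
      using variation_leD[OF V, of m \<tau>] by simp
    moreover have "(\<Sum>i<N. \<bar>f (q i) - f (p i)\<bar>) = (\<Sum>j\<in>(\<lambda>i. 2 * i) ` {..<N}. \<bar>f (\<tau> (Suc j)) - f (\<tau> j)\<bar>)"
      by (subst sum.reindex) (auto simp: inj_on_def \<tau>_def min_def max_def intro!: sum.cong)
    moreover have "\<dots> \<le> (\<Sum>j<m. \<bar>f (\<tau> (Suc j)) - f (\<tau> j)\<bar>)"
      using m by (intro sum_mono2) auto
    ultimately show ?thesis by linarith
  qed
  define c where "c i = \<bar>f (q i) - f (p i)\<bar>" for i
  have ae: "AE t in leb T. \<bar>f t - step T N f p t\<bar> \<le> (\<Sum>i<N. indicator (cell T N i) t * c i)"
    using G AE_cell[OF assms(1,2)]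
  proof eventually_elim
    case (elim t)
    then obtain i where i: "i < N" "t \<in> cell T N i" by blast
    have "\<bar>f t - step T N f p t\<bar> \<le> c i"
      using q(2)[of i t] i elim step_cell[OF i(2,1) assms(1)] by (simp add: c_def)
    also have "\<dots> = indicator (cell T N i) t * c i" using i by simp
    also have "\<dots> \<le> (\<Sum>i<N. indicator (cell T N i) t * c i)"
      using i(1) by (intro member_le_sum[of i]) (auto simp: c_def)
    finally show ?case .
  qed
  have i: "integrable (leb T) (\<lambda>t. \<Sum>i<N. indicator (cell T N i) t * c i)"
    using integral_leb_cell(2)[OF assms(1)] by (intro Bochner_Integration.integrable_sum integrable_mult_left) auto
  show i2: "integrable (leb T) (\<lambda>t. \<bar>f t - step T N f p t\<bar>)"
    by (rule Bochner_Integration.integrable_bound[OF i])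
      (use ae f in \<open>auto elim!: eventually_mono\<close>)
  have "(LINT t|leb T. \<bar>f t - step T N f p t\<bar>) \<le> (LINT t|leb T. (\<Sum>i<N. indicator (cell T N i) t * c i))"
    by (rule integral_mono_AE[OF i2 i ae])
  also have "\<dots> = (\<Sum>i<N. T / real N * c i)"
  proof -
    have "(LINT t|leb T. (\<Sum>i<N. indicator (cell T N i) t * c i))
        = (\<Sum>i<N. LINT t|leb T. indicator (cell T N i) t * c i)"
      using integral_leb_cell(2)[OF assms(1)]
      by (intro Bochner_Integration.integral_sum integrable_mult_left) auto
    also have "\<dots> = (\<Sum>i<N. T / real N * c i)"
      by (intro sum.cong refl)
        (simp only: integral_mult_left_zero integral_leb_cell(1)[OF assms(1)] lessThan_iff)
    finally show ?thesis .
  qed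
  also have "\<dots> = T / real N * (\<Sum>i<N. c i)"
    by (simp add: sum_distrib_left)
  also have "\<dots> \<le> T / real N * V"
    using q_sum \<open>T > 0\<close> unfolding c_def by (intro mult_left_mono) auto
  finally show "(LINT t|leb T. \<bar>f t - step T N f p t\<bar>) \<le> T / real N * V" .
qed

lemma summation_by_parts:
  fixes a b :: "nat \<Rightarrow> real"
  shows "(\<Sum>i<Suc k. a i * (b (Suc i) - b i)) = a k * b (Suc k) - a 0 * b 0 - (\<Sum>i<k. (a (Suc i) - a i) * b (Suc i))"
  by (induction k) (auto simp: algebra_simps)

lemma integral_cell_deriv:
  assumes "\<phi> \<in> C1c T" "T > 0" "i < N"
  shows "(LINT t|leb T. indicator (cell T N i) t * deriv \<phi> t) = \<phi> (real (Suc i) * (T / real N)) - \<phi> (real i * (T / real N))"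
    "integrable (leb T) (\<lambda>t. indicator (cell T N i) t * deriv \<phi> t)"
proof -
  have [measurable]: "cell T N i \<in> sets borel" by (simp add: cell_def)
  have [measurable]: "deriv \<phi> \<in> borel_measurable borel"
    by (rule borel_measurable_continuous_onI[OF C1c_deriv(2)[OF assms(1)]])
  have sub: "cell T N i \<subseteq> {0<..<T}" by (rule cell_subset[OF assms(2,3)])
  define a b where "a = real i * (T / real N)" and "b = real (Suc i) * (T / real N)"
  have "a \<le> b" unfolding a_def b_def using assms by (intro mult_right_mono) auto
  have "(LINT t|leb T. indicator (cell T N i) t * deriv \<phi> t)
      = (LINT t|lborel. indicator {0<..<T} t * (indicator (cell T N i) t * deriv \<phi> t))"
    by (rule integral_leb_borel) measurable
  also have "\<dots> = (LINT t|lborel. deriv \<phi> t * indicator {a..b} t)"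
  proof (rule integral_cong_AE)
    have "AE t in lborel. t \<noteq> a \<and> t \<noteq> b"
      by (auto intro: AE_lborel_singleton)
    then show "AE t in lborel. indicator {0<..<T} t * (indicator (cell T N i) t * deriv \<phi> t) = deriv \<phi> t * indicator {a..b} t"
    proof eventually_elim
      case (elim t)
      then have "t \<in> {a..b} \<longleftrightarrow> t \<in> cell T N i"
        unfolding cell_def a_def[symmetric] b_def[symmetric] by auto
      then show ?case
        using sub by (cases "t \<in> cell T N i") (auto simp del: atLeastAtMost_iff)
    qed
  qed measurable
  also have "\<dots> = \<phi> b - \<phi> a"
    using C1c_deriv[OF assms(1)] \<open>a \<le> b\<close>
    by (intro integral_FTC_Icc_real) (auto simp: continuous_on_eq_continuous_at)
  finally show "(LINT t|leb T. indicator (cell T N i) t * deriv \<phi> t) = \<phi> (real (Suc i) * (T / real N)) - \<phi> (real i * (T / real N))"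
    unfolding a_def b_def .
  obtain L where L: "0 \<le> L" "\<And>t. t \<in> {0<..<T} \<Longrightarrow> \<bar>deriv \<phi> t\<bar> \<le> L"
    using C1c_deriv_bounded[OF assms(1)] by metis
  show "integrable (leb T) (\<lambda>t. indicator (cell T N i) t * deriv \<phi> t)"
    by (rule integrable_leb_bounded[of _ _ L])
      (use L in \<open>auto intro!: borel_measurable_lebI simp: indicator_def AE_leb_iff\<close>)
qed

text \<open>Against a fixed test function, replacing \<open>f\<close> by its step function costs at
  most \<open>T / N * V * L\<close>, where \<open>L\<close> bounds the derivative; this vanishes as
  the grid is refined. For the step function, summation by parts moves the differences onto
  \<open>f\<close>, and the remaining values of \<open>\<phi>\<close> are at most 1 in
  modulus.\<close>

lemma TV_le_variation:
  assumes "T > 0" "finite (f ` G)" and G: "AE t in leb T. t \<in> G"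
    and f: "f \<in> borel_measurable (leb T)" and V: "variation_le G f (ereal V)"
  shows "TV T f \<le> ereal V"
proof (rule TV_le)
  fix \<phi> assume \<phi>: "\<phi> \<in> C1c T" "\<And>t. \<bar>\<phi> t\<bar> \<le> 1"
  obtain L where L: "0 \<le> L" "\<And>t. t \<in> {0<..<T} \<Longrightarrow> \<bar>deriv \<phi> t\<bar> \<le> L"
    using C1c_deriv_bounded[OF \<phi>(1)] by metis
  note [measurable] = C1c_deriv_measurable[OF \<phi>(1)] f
  have "(LINT t|leb T. f t * deriv \<phi> t) \<le> V + T * V * L * (1 / real (Suc k))" for k
  proof -
    let ?N = "Suc k"
    have "\<exists>p. p \<in> G \<inter> cell T ?N i" if "i < ?N" for i
      by (rule full_measure_meets_cell[OF assms(1) G that])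
    then obtain p where p: "\<And>i. i < ?N \<Longrightarrow> p i \<in> G \<inter> cell T ?N i" by metis
    let ?s = "step T ?N f p"
    have st: "integrable (leb T) (\<lambda>t. \<bar>f t - ?s t\<bar>)" "(LINT t|leb T. \<bar>f t - ?s t\<bar>) \<le> T / real ?N * V"
      by (rule step_approximation[OF assms(1) _ assms(2) G f _ V]; use p in simp)+
    have i1: "integrable (leb T) (\<lambda>t. ?s t * deriv \<phi> t)"
      unfolding step_def sum_distrib_right
      using integral_cell_deriv(2)[OF \<phi>(1) assms(1)]
      by (intro Bochner_Integration.integrable_sum) (simp add: mult.assoc mult.left_commute)
    have ae: "AE t in leb T. \<bar>(f t - ?s t) * deriv \<phi> t\<bar> \<le> \<bar>f t - ?s t\<bar> * L"
      using L by (auto simp: AE_leb_iff abs_mult intro!: AE_I2 mult_left_mono)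
    have i2: "integrable (leb T) (\<lambda>t. (f t - ?s t) * deriv \<phi> t)"
    proof (rule Bochner_Integration.integrable_bound)
      show "integrable (leb T) (\<lambda>t. \<bar>f t - ?s t\<bar> * L)"
        using st(1) by (intro integrable_mult_left) auto
    qed (use ae L in \<open>auto simp: abs_mult\<close>)
    have "(LINT t|leb T. f t * deriv \<phi> t) = (LINT t|leb T. (f t - ?s t) * deriv \<phi> t + ?s t * deriv \<phi> t)"
      by (simp add: algebra_simps)
    also have "\<dots> = (LINT t|leb T. (f t - ?s t) * deriv \<phi> t) + (LINT t|leb T. ?s t * deriv \<phi> t)"
      using i1 i2 by (rule Bochner_Integration.integral_add[rotated])
    also have "(LINT t|leb T. (f t - ?s t) * deriv \<phi> t) \<le> (LINT t|leb T. \<bar>f t - ?s t\<bar> * L)"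
      using ae st(1) by (intro integral_mono_AE i2 integrable_mult_left) auto
    also have "\<dots> \<le> T / real ?N * V * L"
      using mult_right_mono[OF st(2) L(1)] by simp
    also have "(LINT t|leb T. ?s t * deriv \<phi> t)
        = (\<Sum>i<?N. f (p i) * (\<phi> (real (Suc i) * (T / real ?N)) - \<phi> (real i * (T / real ?N))))"
    proof -
      have "(LINT t|leb T. ?s t * deriv \<phi> t)
          = (LINT t|leb T. (\<Sum>i<?N. f (p i) * (indicator (cell T ?N i) t * deriv \<phi> t)))"
        unfolding step_def sum_distrib_right by (simp add: mult_ac)
      also have "\<dots> = (\<Sum>i<?N. f (p i) * (LINT t|leb T. indicator (cell T ?N i) t * deriv \<phi> t))"
        using integral_cell_deriv(2)[OF \<phi>(1) assms(1)]
        by (subst Bochner_Integration.integral_sum) auto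
      finally show ?thesis
        using integral_cell_deriv(1)[OF \<phi>(1) assms(1)] by simp
    qed
    \<comment> \<open>The boundary terms vanish because \<open>\<phi>\<close> is 0 at both ends of
      the interval.\<close>
    also have "\<dots> = - (\<Sum>i<k. (f (p (Suc i)) - f (p i)) * \<phi> (real (Suc i) * (T / real ?N)))"
      using summation_by_parts[of "\<lambda>i. f (p i)" "\<lambda>i. \<phi> (real i * (T / real ?N))" k]
        C1c_eq_0[OF \<phi>(1), of 0] C1c_eq_0[OF \<phi>(1), of T] by simp
    also have "\<dots> \<le> (\<Sum>i<k. \<bar>f (p (Suc i)) - f (p i)\<bar>)"
      unfolding sum_negf[symmetric]
    proof (rule sum_mono)
      fix i
      have "\<bar>(f (p (Suc i)) - f (p i)) * \<phi> (real (Suc i) * (T / real ?N))\<bar> \<le> \<bar>f (p (Suc i)) - f (p i)\<bar> * 1"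
        unfolding abs_mult by (intro mult_left_mono \<phi>(2)) auto
      then show "- ((f (p (Suc i)) - f (p i)) * \<phi> (real (Suc i) * (T / real ?N))) \<le> \<bar>f (p (Suc i)) - f (p i)\<bar>"
        by (intro abs_le_D2) (simp only: mult_1_right)
    qed
    also have "\<dots> \<le> V"
    proof -
      have "p i \<le> p (Suc i)" if "i < k" for i
        using p[of i] p[of "Suc i"] that by (auto simp: cell_def)
      then show ?thesis using variation_leD[OF V, of k p] p by auto
    qed
    finally show ?thesis by (simp add: algebra_simps)
  qed
  moreover have "(\<lambda>k. V + T * V * L * (1 / real (Suc k))) \<longlonglongrightarrow> V + T * V * L * 0"
    by (intro tendsto_intros LIMSEQ_Suc[OF lim_1_over_n])
  ultimately have "(LINT t|leb T. f t * deriv \<phi> t) \<le> V"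
    by (intro LIMSEQ_le_const[of "\<lambda>k. V + T * V * L * (1 / real (Suc k))"]) auto
  then show "ereal (LINT t|leb T. f t * deriv \<phi> t) \<le> ereal V" by simp
qed


section \<open>Integer-valued functions of bounded variation\<close>

text \<open>A sum in place of a maximum, so that an empty \<open>W\<close> needs no separate
  treatment.\<close>

definition abs_bound :: "int set \<Rightarrow> real" where
  "abs_bound W = (\<Sum>k\<in>W. \<bar>real_of_int k\<bar>)"

lemma abs_bound_nonneg: "0 \<le> abs_bound W"
  by (simp add: abs_bound_def sum_nonneg)

lemma abs_bound: "finite W \<Longrightarrow> x \<in> real_of_int ` W \<Longrightarrow> \<bar>x\<bar> \<le> abs_bound W"
  unfolding abs_bound_def by (auto intro: member_le_sum[where f = "\<lambda>k. \<bar>real_of_int k\<bar>"])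

lemma BVW_D:
  assumes "w \<in> BVW T W"
  shows "w \<in> borel_measurable (leb T)" "integrable (leb T) w" "TV T w < \<infinity>"
    "AE t in leb T. w t \<in> real_of_int ` W"
  using assms unfolding BVW_def BV_def by auto

lemma BVW_abs_bound:
  assumes "w \<in> BVW T W" "finite W"
  shows "AE t in leb T. \<bar>w t\<bar> \<le> abs_bound W"
  using BVW_D(4)[OF assms(1)] by eventually_elim (rule abs_bound[OF assms(2)])

lemma BVW_I:
  assumes "w \<in> borel_measurable (leb T)" "AE t in leb T. w t \<in> real_of_int ` W" "TV T w < \<infinity>" "finite W"
  shows "w \<in> BVW T W"
proof -
  have "AE t in leb T. \<bar>w t\<bar> \<le> abs_bound W"
    using assms(2) by eventually_elim (rule abs_bound[OF assms(4)])
  then show ?thesis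
    using assms integrable_leb_bounded unfolding BVW_def BV_def by blast
qed

lemma BVW_TV_real:
  assumes "w \<in> BVW T W"
  obtains V where "TV T w = ereal V" "0 \<le> V"
  using BVW_D(3)[OF assms] TV_nonneg[of T w] by (cases "TV T w") auto

context mollifier
begin

lemma BVW_chain:
  assumes "T > 0" "finite W" "w \<in> BVW T W"
  shows "\<exists>G\<subseteq>{0<..<T}. (AE t in leb T. t \<in> G) \<and> variation_le G w (TV T w) \<and> w ` G \<subseteq> real_of_int ` W"
proof -
  obtain G where G: "G \<subseteq> {0<..<T}" "AE t in leb T. t \<in> G" "variation_le G w (TV T w)"
    using ex_variation_le_TV[OF BVW_D(1)[OF assms(3)] BVW_abs_bound[OF assms(3,2)] abs_bound_nonneg assms(1)]
    by blast
  have "AE t in leb T. t \<in> G \<inter> {t. w t \<in> real_of_int ` W}"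
    using G(2) BVW_D(4)[OF assms(3)] by eventually_elim simp
  then show ?thesis
    using G variation_le_subset[OF G(3), of "G \<inter> {t. w t \<in> real_of_int ` W}"]
    by (intro exI[of _ "G \<inter> {t. w t \<in> real_of_int ` W}"]) auto
qed

text \<open>Chain sums over \<open>G\<close> are integers between 0 and \<open>V\<close>, so only
  finitely many values occur and their supremum is attained. By \<open>TV_le_variation\<close> this
  maximum also bounds \<open>TV T w\<close>, which is therefore itself one of these
  integers.\<close>

lemma BVW_TV_integer:
  assumes "T > 0" "finite W" "w \<in> BVW T W"
  shows "\<exists>k::int. TV T w = ereal (of_int k)"
proof -
  obtain V where V: "TV T w = ereal V" "0 \<le> V"
    using BVW_TV_real[OF assms(3)] .
  obtain G where G: "G \<subseteq> {0<..<T}" "AE t in leb T. t \<in> G" "variation_le G w (TV T w)"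
    "w ` G \<subseteq> real_of_int ` W"
    using BVW_chain[OF assms] by blast
  \<comment> \<open>Inserting 0 makes \<open>S\<close> nonempty without exhibiting a chain.\<close>
  define S where "S = insert 0 {\<Sum>i<m. \<bar>w (t (Suc i)) - w (t i)\<bar> | m t. (\<forall>i<m. t i \<le> t (Suc i)) \<and> (\<forall>i\<le>m. t i \<in> G)}"
  have S_le: "s \<le> V" if "s \<in> S" for s
    using that variation_leD[OF G(3)] V unfolding S_def by auto
  have S_int: "s \<in> real_of_int ` {0..\<lfloor>V\<rfloor>}" if sS: "s \<in> S" for s
  proof -
    have "s \<in> \<int>"
    proof (cases "s = 0")
      case False
      then obtain m t where s: "s = (\<Sum>i<m. \<bar>w (t (Suc i)) - w (t i)\<bar>)" "\<forall>i\<le>m. t i \<in> G"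
        using sS unfolding S_def by blast
      have "w (t i) \<in> \<int>" if "i \<le> m" for i
      proof -
        have "w (t i) \<in> real_of_int ` W" using G(4) s(2) that by blast
        then show ?thesis by auto
      qed
      then show ?thesis
        unfolding s(1) by (intro Ints_sum) auto
    qed simp
    then obtain k where k: "s = real_of_int k" by (auto elim: Ints_cases)
    moreover have "0 \<le> s"
      using that unfolding S_def by (auto intro: sum_nonneg)
    ultimately show ?thesis
      using S_le[OF that] by (auto simp: le_floor_iff)
  qed
  then have "finite S"
    by (meson finite_atLeastAtMost_int finite_imageI finite_subset subsetI)
  moreover have "S \<noteq> {}" by (simp add: S_def)
  ultimately have M: "Max S \<in> S" "\<And>s. s \<in> S \<Longrightarrow> s \<le> Max S" by auto
  have "variation_le G w (ereal (Max S))"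
    unfolding variation_le_def using M(2) unfolding S_def by auto
  moreover have "finite (w ` G)"
    using G(4) assms(2) by (meson finite_imageI finite_subset)
  ultimately have "TV T w \<le> ereal (Max S)"
    using TV_le_variation[OF assms(1) _ G(2) BVW_D(1)[OF assms(3)]] by blast
  then have "Max S = V" using S_le[OF M(1)] V by simp
  then show ?thesis using S_int[OF M(1)] V by auto
qed

end

section \<open>Lower semicontinuity, and compactness in L1\<close>

lemma TV_lower_semicontinuous:
  assumes u: "\<And>n. integrable (leb T) (u n)" and v: "integrable (leb T) v"
    and lim: "(\<lambda>n. L1_norm T (\<lambda>t. u n t - v t)) \<longlonglongrightarrow> 0"
  shows "TV T v \<le> liminf (\<lambda>n. TV T (u n))"
proof (rule TV_le)
  fix \<phi> assume \<phi>: "\<phi> \<in> C1c T" "\<And>t. \<bar>\<phi> t\<bar> \<le> 1"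
  obtain L where L: "0 \<le> L" "\<And>t. t \<in> {0<..<T} \<Longrightarrow> \<bar>deriv \<phi> t\<bar> \<le> L"
    using C1c_deriv_bounded[OF \<phi>(1)] by metis
  note [measurable] = C1c_deriv_measurable[OF \<phi>(1)]
  \<comment> \<open>The bound on the derivative makes each functional in the supremum defining
    \<open>TV\<close> continuous in L1; a supremum of such functionals is lower
    semicontinuous.\<close>
  have ae: "AE t in leb T. \<bar>f t * deriv \<phi> t\<bar> \<le> \<bar>f t\<bar> * L" for f
    using L by (auto simp: AE_leb_iff abs_mult intro!: AE_I2 mult_left_mono)
  have i: "integrable (leb T) (\<lambda>t. f t * deriv \<phi> t)" if "integrable (leb T) f" for f
  proof (rule Bochner_Integration.integrable_bound)
    show "integrable (leb T) (\<lambda>t. \<bar>f t\<bar> * L)"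
      using that by (intro integrable_mult_left) auto
    show "AE t in leb T. norm (f t * deriv \<phi> t) \<le> norm (\<bar>f t\<bar> * L)"
      using ae[of f] L by (simp add: abs_mult)
  qed (use that in auto)
  have "(\<lambda>n. (LINT t|leb T. u n t * deriv \<phi> t) - (LINT t|leb T. v t * deriv \<phi> t)) \<longlonglongrightarrow> 0"
  proof (rule Lim_null_comparison)
    show "(\<lambda>n. L1_norm T (\<lambda>t. u n t - v t) * L) \<longlonglongrightarrow> 0"
      using tendsto_mult_right[OF lim, of L] by simp
    show "\<forall>\<^sub>F n in sequentially. norm ((LINT t|leb T. u n t * deriv \<phi> t) - (LINT t|leb T. v t * deriv \<phi> t))
        \<le> L1_norm T (\<lambda>t. u n t - v t) * L"
    proof (intro always_eventually allI)
      fix n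
      have d: "integrable (leb T) (\<lambda>t. u n t - v t)" using u v by simp
      have "(LINT t|leb T. u n t * deriv \<phi> t) - (LINT t|leb T. v t * deriv \<phi> t)
          = (LINT t|leb T. (u n t - v t) * deriv \<phi> t)"
        using i[OF u[of n]] i[OF v] by (simp add: left_diff_distrib)
      also have "norm \<dots> \<le> (LINT t|leb T. \<bar>(u n t - v t) * deriv \<phi> t\<bar>)"
        unfolding real_norm_def by (rule integral_abs_bound)
      also have "\<dots> \<le> (LINT t|leb T. \<bar>u n t - v t\<bar> * L)"
        using d by (intro integral_mono_AE ae integrable_abs i) auto
      also have "\<dots> = L1_norm T (\<lambda>t. u n t - v t) * L"
        by (simp add: L1_norm_def)
      finally show "norm ((LINT t|leb T. u n t * deriv \<phi> t) - (LINT t|leb T. v t * deriv \<phi> t))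
        \<le> L1_norm T (\<lambda>t. u n t - v t) * L" .
    qed
  qed
  then have "(\<lambda>n. ereal (LINT t|leb T. u n t * deriv \<phi> t)) \<longlonglongrightarrow> ereal (LINT t|leb T. v t * deriv \<phi> t)"
    using LIM_zero_iff by auto
  then have "ereal (LINT t|leb T. v t * deriv \<phi> t) = liminf (\<lambda>n. ereal (LINT t|leb T. u n t * deriv \<phi> t))"
    by (rule lim_imp_Liminf[OF sequentially_bot, symmetric])
  also have "\<dots> \<le> liminf (\<lambda>n. TV T (u n))"
    using TV_ge[OF \<phi>] by (intro Liminf_mono always_eventually) auto
  finally show "ereal (LINT t|leb T. v t * deriv \<phi> t) \<le> liminf (\<lambda>n. TV T (u n))" .
qed

text \<open>A subsequence converges almost everywhere, and closedness applies pointwise. With a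
  finite set of admissible values, L1 limits stay admissible.\<close>

lemma AE_closed_L1_limit:
  assumes u: "\<And>n. integrable (leb T) (u n)" and v: "integrable (leb T) v"
    and lim: "(\<lambda>n. L1_norm T (\<lambda>t. u n t - v t)) \<longlonglongrightarrow> 0"
    and S: "closed S" "\<And>n. AE t in leb T. u n t \<in> S"
  shows "AE t in leb T. v t \<in> S"
proof -
  obtain r where r: "strict_mono r" "AE t in leb T. (\<lambda>n. u (r n) t - v t) \<longlonglongrightarrow> 0"
    using tendsto_L1_AE_subseq[of "leb T" "\<lambda>n t. u n t - v t"] u v lim unfolding L1_norm_def by auto
  have "AE t in leb T. \<forall>n. u n t \<in> S"
    using S(2) by (simp add: AE_all_countable)
  with r(2) show ?thesis
  proof eventually_elim
    case (elim t)
    then have "(\<lambda>n. u (r n) t) \<longlonglongrightarrow> v t" by (simp add: LIM_zero_iff)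
    then show ?case using closed_sequentially[OF S(1), of "\<lambda>n. u (r n) t" "v t"] elim(2) by simp
  qed
qed

text \<open>Tychonoff's theorem takes the place of a diagonal argument: the product of intervals is
  compact, and a countable index type makes the product metrizable, so compactness yields convergent
  subsequences.\<close>

lemma bounded_sequences_coordinatewise_convergent:
  fixes X :: "nat \<Rightarrow> 'i::countable \<Rightarrow> real"
  assumes "\<And>n i. \<bar>X n i\<bar> \<le> B"
  obtains r :: "nat \<Rightarrow> nat" and l where "strict_mono r" "\<And>i. (\<lambda>n. X (r n) i) \<longlonglongrightarrow> l i"
proof -
  have "compactin (product_topology (\<lambda>i::'i. euclidean) UNIV) (PiE UNIV (\<lambda>i. {-B..B}))"
    unfolding compactin_PiE by simp
  then have "compact (PiE UNIV (\<lambda>i::'i. {-B..B}))"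
    by (simp add: euclidean_product_topology)
  then have "seq_compact (PiE UNIV (\<lambda>i::'i. {-B..B}))"
    by (simp add: compact_eq_seq_compact_metric)
  moreover have "\<forall>n. X n \<in> PiE UNIV (\<lambda>i::'i. {-B..B})"
    using assms by (auto simp: abs_le_iff minus_le_iff PiE_iff)
  ultimately obtain l r where r: "strict_mono r" "(X \<circ> r) \<longlonglongrightarrow> l"
    by (rule seq_compactE)
  have "(\<lambda>n. X (r n) i) \<longlonglongrightarrow> l i" for i
    using continuous_on_tendsto_compose[OF continuous_on_product_coordinates[of i] r(2)] by simp
  with r(1) that show ?thesis by blast
qed

text \<open>The triangle inequality through the two step functions on a common grid with common
  sample points. It reduces closeness in L1 to closeness at finitely many points, up to an error
  governed by mesh and variation.\<close>

lemma L1_distance_by_steps: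
  assumes "T > 0" "N > 0" and G: "AE t in leb T. t \<in> G"
    and p: "\<And>i. i < N \<Longrightarrow> p i \<in> G \<inter> cell T N i"
    and u: "integrable (leb T) u" "finite (u ` G)" "variation_le G u (ereal M)"
    and v: "integrable (leb T) v" "finite (v ` G)" "variation_le G v (ereal M)"
  shows "(LINT t|leb T. \<bar>u t - v t\<bar>) \<le> 2 * (T / real N * M) + T / real N * (\<Sum>i<N. \<bar>u (p i) - v (p i)\<bar>)"
proof -
  let ?s = "\<lambda>f. step T N f p"
  note us = step_approximation[OF assms(1,2) u(2) G borel_measurable_integrable[OF u(1)] p u(3)]
  note vs = step_approximation[OF assms(1,2) v(2) G borel_measurable_integrable[OF v(1)] p v(3)]
  have ci: "integrable (leb T) (\<lambda>t. indicator (cell T N i) t * c)" if "i < N" for i and c :: real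
    by (rule integrable_mult_left) (rule integral_leb_cell(2)[OF assms(1) that])
  have si: "integrable (leb T) (\<lambda>t. \<Sum>i<N. indicator (cell T N i) t * \<bar>u (p i) - v (p i)\<bar>)"
    using ci by (intro Bochner_Integration.integrable_sum) auto
  have "(LINT t|leb T. \<bar>u t - v t\<bar>)
      \<le> (LINT t|leb T. \<bar>u t - ?s u t\<bar> + \<bar>v t - ?s v t\<bar> + (\<Sum>i<N. indicator (cell T N i) t * \<bar>u (p i) - v (p i)\<bar>))"
  proof (rule integral_mono)
    fix t
    have "\<bar>?s u t - ?s v t\<bar> \<le> (\<Sum>i<N. \<bar>indicator (cell T N i) t * u (p i) - indicator (cell T N i) t * v (p i)\<bar>)"
      unfolding step_def sum_subtractf[symmetric] by (rule sum_abs)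
    also have "\<dots> = (\<Sum>i<N. indicator (cell T N i) t * \<bar>u (p i) - v (p i)\<bar>)"
      by (intro sum.cong refl) (simp add: right_diff_distrib[symmetric] abs_mult)
    finally show "\<bar>u t - v t\<bar> \<le> \<bar>u t - ?s u t\<bar> + \<bar>v t - ?s v t\<bar> + (\<Sum>i<N. indicator (cell T N i) t * \<bar>u (p i) - v (p i)\<bar>)"
      by linarith
  qed (use u(1) v(1) us(1) vs(1) si in auto)
  also have "\<dots> = (LINT t|leb T. \<bar>u t - ?s u t\<bar>) + (LINT t|leb T. \<bar>v t - ?s v t\<bar>)
      + (LINT t|leb T. (\<Sum>i<N. indicator (cell T N i) t * \<bar>u (p i) - v (p i)\<bar>))"
    using us(1) vs(1) si by (simp del: sum_mult_indicator)
  also have "(LINT t|leb T. (\<Sum>i<N. indicator (cell T N i) t * \<bar>u (p i) - v (p i)\<bar>))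
      = (\<Sum>i<N. LINT t|leb T. indicator (cell T N i) t * \<bar>u (p i) - v (p i)\<bar>)"
    using ci by (intro Bochner_Integration.integral_sum) auto
  also have "\<dots> = (\<Sum>i<N. T / real N * \<bar>u (p i) - v (p i)\<bar>)"
    by (intro sum.cong refl)
      (simp only: integral_mult_left_zero integral_leb_cell(1)[OF assms(1)] lessThan_iff)
  also have "\<dots> = T / real N * (\<Sum>i<N. \<bar>u (p i) - v (p i)\<bar>)"
    by (simp add: sum_distrib_left)
  also have "(LINT t|leb T. \<bar>u t - ?s u t\<bar>) \<le> T / real N * M"
    by (rule us(2))
  also have "(LINT t|leb T. \<bar>v t - ?s v t\<bar>) \<le> T / real N * M"
    by (rule vs(2))
  finally show ?thesis
    by (simp add: mult.commute)
qed

context mollifier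
begin

text \<open>A Helly-type selection: all functions are sampled at the same countably many points, one
  per cell of each grid. Convergence of all samples makes the subsequence Cauchy in L1, and
  membership of the limit follows from lower semicontinuity and the finiteness of
  \<open>W\<close>.\<close>

lemma BVW_compact:
  fixes w :: "nat \<Rightarrow> real \<Rightarrow> real"
  assumes "T > 0" "finite W" and w: "\<And>n. w n \<in> BVW T W" and M: "\<And>n. TV T (w n) \<le> ereal M"
  obtains r :: "nat \<Rightarrow> nat" and v where "strict_mono r" "v \<in> BVW T W" "(\<lambda>n. L1_norm T (\<lambda>t. w (r n) t - v t)) \<longlonglongrightarrow> 0"
proof -
  have "\<exists>G. \<forall>n. G n \<subseteq> {0<..<T} \<and> (AE t in leb T. t \<in> G n) \<and> variation_le (G n) (w n) (TV T (w n)) \<and> w n ` G n \<subseteq> real_of_int ` W"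
    using BVW_chain[OF assms(1,2) w] by metis
  then obtain G' where G': "\<And>n. AE t in leb T. t \<in> G' n" "\<And>n. variation_le (G' n) (w n) (TV T (w n))"
    "\<And>n. w n ` G' n \<subseteq> real_of_int ` W"
    by blast
  \<comment> \<open>Countably many sets of full measure intersect in one of full measure, so the
    sample points can be shared by all members of the sequence.\<close>
  define G where "G = (\<Inter>n. G' n)"
  have G: "AE t in leb T. t \<in> G"
    using G'(1) by (simp add: G_def AE_all_countable)
  have GV: "variation_le G (w n) (ereal M)" for n
  proof -
    have "variation_le G (w n) (TV T (w n))"
      by (rule variation_le_subset[OF G'(2)]) (auto simp: G_def)
    then show ?thesis
      using M[of n] unfolding variation_le_def by (meson order.trans)
  qed
  have GW: "w n ` G \<subseteq> real_of_int ` W" for n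
    using G'(3)[of n] by (auto simp: G_def)
  have Gfin: "finite (w n ` G)" for n
    using GW[of n] assms(2) by (meson finite_imageI finite_subset)
  have "\<exists>p. p \<in> G \<inter> cell T (Suc k) i" if "i < Suc k" for i k
    by (rule full_measure_meets_cell[OF assms(1) G that])
  then have "\<forall>k. \<exists>q. \<forall>i. i < Suc k \<longrightarrow> q i \<in> G \<inter> cell T (Suc k) i"
    by (intro allI choice) blast
  then obtain p where p: "\<And>k i. i < Suc k \<Longrightarrow> p k i \<in> G \<inter> cell T (Suc k) i"
    using choice[of "\<lambda>k q. \<forall>i. i < Suc k \<longrightarrow> q i \<in> G \<inter> cell T (Suc k) i"] by blast
  \<comment> \<open>All grids are packed into one sequence indexed by pairs of grid and cell;
    indices without a cell are filled with 0.\<close>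
  define X where "X n = (\<lambda>(k, i). if i < Suc k then w n (p k i) else 0)" for n
  have "\<bar>X n ki\<bar> \<le> abs_bound W" for n ki
  proof -
    have "\<bar>w n (p k i)\<bar> \<le> abs_bound W" if "i < Suc k" for k i
      using abs_bound[OF assms(2)] GW[of n] p[OF that] by blast
    then show ?thesis
      using abs_bound_nonneg by (auto simp: X_def split: prod.split)
  qed
  then obtain r l where r: "strict_mono r" and l: "\<And>ki. (\<lambda>n. X (r n) ki) \<longlonglongrightarrow> l ki"
    using bounded_sequences_coordinatewise_convergent by metis
  have wi: "integrable (leb T) (w n)" for n by (rule BVW_D(2)[OF w])
  have cauchy: "\<exists>N. \<forall>i\<ge>N. \<forall>j\<ge>N. (LINT t|leb T. norm (w (r i) t - w (r j) t)) < e" if "e > 0" for e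
  proof -
    \<comment> \<open>The grid is fixed before the tail of the sequence is chosen: the mesh error
      depends only on the common variation bound \<open>M\<close>, and finitely many sample points
      remain to be controlled.\<close>
    have "(\<lambda>k. 2 * (T * (1 / real (Suc k)) * M)) \<longlonglongrightarrow> 2 * (T * 0 * M)"
      by (intro tendsto_intros LIMSEQ_Suc[OF lim_1_over_n])
    then have "eventually (\<lambda>k. 2 * (T * (1 / real (Suc k)) * M) < e / 2) sequentially"
      using that by (intro order_tendstoD) auto
    then obtain k where k: "2 * (T * (1 / real (Suc k)) * M) < e / 2"
      using eventually_happens' sequentially_bot by blast
    have "Cauchy (\<lambda>n. w (r n) (p k i))" if "i < Suc k" for i
      using LIMSEQ_imp_Cauchy[OF l[of "(k, i)"]] that by (simp add: X_def)
    \<comment> \<open>Sample errors below \<open>e / (2 * T)\<close>, weighted by cells of total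
      length \<open>T\<close>, contribute at most \<open>e / 2\<close>.\<close>
    then have "\<exists>N. \<forall>a\<ge>N. \<forall>b\<ge>N. \<bar>w (r a) (p k i) - w (r b) (p k i)\<bar> < e / (2 * T)" if "i < Suc k" for i
      using that \<open>e > 0\<close> \<open>T > 0\<close> unfolding Cauchy_def dist_real_def by simp
    then obtain N where N: "\<And>i a b. i < Suc k \<Longrightarrow> a \<ge> N i \<Longrightarrow> b \<ge> N i \<Longrightarrow> \<bar>w (r a) (p k i) - w (r b) (p k i)\<bar> < e / (2 * T)"
      by metis
    have "(LINT t|leb T. norm (w (r a) t - w (r b) t)) < e"
      if a: "a \<ge> Max (N ` {..k})" and b: "b \<ge> Max (N ` {..k})" for a b
    proof -
      have Nm: "N i \<le> Max (N ` {..k})" if "i < Suc k" for i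
        using that by (intro Max_ge) auto
      have s: "(\<Sum>i<Suc k. \<bar>w (r a) (p k i) - w (r b) (p k i)\<bar>) \<le> (\<Sum>i<Suc k. e / (2 * T))"
        using N a b Nm by (intro sum_mono less_imp_le) (meson lessThan_iff order.trans)
      have "(LINT t|leb T. \<bar>w (r a) t - w (r b) t\<bar>)
          \<le> 2 * (T / real (Suc k) * M) + T / real (Suc k) * (\<Sum>i<Suc k. \<bar>w (r a) (p k i) - w (r b) (p k i)\<bar>)"
        by (rule L1_distance_by_steps[OF assms(1) _ G p wi Gfin GV wi Gfin GV]) auto
      also have "\<dots> \<le> 2 * (T / real (Suc k) * M) + T / real (Suc k) * (\<Sum>i<Suc k. e / (2 * T))"
        using s \<open>T > 0\<close> by (intro add_left_mono mult_left_mono) auto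
      also have "T / real (Suc k) * (\<Sum>i<Suc k. e / (2 * T)) = e / 2"
        using \<open>T > 0\<close> by (simp del: of_nat_Suc)
      also have "2 * (T / real (Suc k) * M) + e / 2 < e"
        using k by simp
      finally show ?thesis by simp
    qed
    then show ?thesis by blast
  qed
  obtain r' where r': "strict_mono r'" "AE t in leb T. Cauchy (\<lambda>i. w (r (r' i)) t)"
    using cauchy_L1_AE_cauchy_subseq[of "leb T" "\<lambda>n. w (r n)", OF wi cauchy] by blast
  define R where "R = r \<circ> r'"
  have R: "strict_mono R" using r r'(1) by (simp add: R_def strict_mono_o)
  \<comment> \<open>\<open>lim\<close> yields a value at every point and keeps measurability; off a
    null set it is the actual limit.\<close>
  define v where "v t = lim (\<lambda>i. w (R i) t)" for t
  have [measurable]: "w n \<in> borel_measurable (leb T)" for n by (rule BVW_D(1)[OF w])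
  have v_meas [measurable]: "v \<in> borel_measurable (leb T)"
    unfolding v_def[abs_def] by measurable
  have wB: "AE t in leb T. \<forall>n. \<bar>w n t\<bar> \<le> abs_bound W"
    using BVW_abs_bound[OF w assms(2)] by (simp add: AE_all_countable)
  have conv: "AE t in leb T. (\<lambda>i. w (R i) t) \<longlonglongrightarrow> v t"
    using r'(2) by eventually_elim (simp add: v_def R_def Cauchy_convergent_iff convergent_LIMSEQ_iff)
  have vB: "AE t in leb T. \<bar>v t\<bar> \<le> abs_bound W"
    using conv wB
  proof eventually_elim
    case (elim t)
    have "(\<lambda>i. \<bar>w (R i) t\<bar>) \<longlonglongrightarrow> \<bar>v t\<bar>" using elim(1) by (rule tendsto_rabs)
    then show ?case using elim(2) by (intro LIMSEQ_le_const2) auto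
  qed
  have vi: "integrable (leb T) v" using v_meas vB by (rule integrable_leb_bounded)
  have "(\<lambda>i. LINT t|leb T. \<bar>w (R i) t - v t\<bar>) \<longlonglongrightarrow> (LINT t|leb T. 0)"
  proof (rule integral_dominated_convergence)
    show "integrable (leb T) (\<lambda>t. 2 * abs_bound W)"
      by (rule integrable_leb_bounded[of _ _ "2 * abs_bound W"]) (auto simp: abs_bound_nonneg)
    show "AE t in leb T. (\<lambda>i. \<bar>w (R i) t - v t\<bar>) \<longlonglongrightarrow> 0"
      using conv by eventually_elim (simp add: LIM_zero tendsto_rabs_zero)
    show "AE t in leb T. norm \<bar>w (R i) t - v t\<bar> \<le> 2 * abs_bound W" for i
      using wB vB
    proof eventually_elim
      case (elim t)
      then have "\<bar>w (R i) t\<bar> \<le> abs_bound W" by blast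
      then show ?case using elim(2) unfolding real_norm_def by linarith
    qed
  qed auto
  then have L1: "(\<lambda>n. L1_norm T (\<lambda>t. w (R n) t - v t)) \<longlonglongrightarrow> 0"
    by (simp add: L1_norm_def)
  have "TV T v \<le> liminf (\<lambda>n. TV T (w (R n)))"
    by (rule TV_lower_semicontinuous[OF wi vi L1])
  also have "\<dots> \<le> liminf (\<lambda>n. ereal M)"
    using M by (intro Liminf_mono always_eventually) auto
  also have "\<dots> = ereal M" by (simp add: Liminf_const)
  finally have "TV T v < \<infinity>" by auto
  moreover have "AE t in leb T. v t \<in> real_of_int ` W"
    using assms(2) by (intro AE_closed_L1_limit[OF wi vi L1] finite_imp_closed finite_imageI BVW_D(4)[OF w])
  ultimately have "v \<in> BVW T W"
    using v_meas assms(2) by (intro BVW_I)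
  with R L1 that show ?thesis by blast
qed

end


section \<open>Trust-region steps\<close>

lemma L2_bounded:
  assumes "f \<in> borel_measurable (leb T)" "AE t in leb T. \<bar>f t\<bar> \<le> B"
  shows "f \<in> L2 T"
proof -
  have "AE t in leb T. \<bar>(f t)\<^sup>2\<bar> \<le> B\<^sup>2"
    using assms(2) by eventually_elim (simp add: abs_le_square_iff[symmetric])
  then show ?thesis
    using assms(1) unfolding L2_def by (auto intro!: integrable_leb_bounded)
qed

lemma L2_add_scaled:
  assumes "f \<in> L2 T" "g \<in> L2 T"
  shows "(\<lambda>t. f t + c * g t) \<in> L2 T"
proof -
  have [measurable]: "f \<in> borel_measurable (leb T)" "g \<in> borel_measurable (leb T)"
    and i: "integrable (leb T) (\<lambda>t. 2 * (f t)\<^sup>2 + 2 * c\<^sup>2 * (g t)\<^sup>2)"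
    using assms by (auto simp: L2_def)
  have "(f t + c * g t)\<^sup>2 \<le> 2 * (f t)\<^sup>2 + 2 * c\<^sup>2 * (g t)\<^sup>2" for t
    using zero_le_power2[of "f t - c * g t"] by (simp add: power2_eq_square algebra_simps)
  then have "integrable (leb T) (\<lambda>t. (f t + c * g t)\<^sup>2)"
    by (intro Bochner_Integration.integrable_bound[OF i] AE_I2) auto
  then show ?thesis by (simp add: L2_def)
qed

lemma L2_norm_nonneg: "0 \<le> L2_norm T f"
  by (simp add: L2_norm_def L2_inner_def)

lemma L2_norm_scaled: "L2_norm T (\<lambda>t. c * f t) = \<bar>c\<bar> * L2_norm T f"
proof -
  have "L2_inner T (\<lambda>t. c * f t) (\<lambda>t. c * f t) = (LINT t|leb T. c\<^sup>2 * (f t * f t))"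
    unfolding L2_inner_def by (intro Bochner_Integration.integral_cong) (auto simp: power2_eq_square)
  also have "\<dots> = c\<^sup>2 * L2_inner T f f"
    unfolding L2_inner_def by simp
  finally show ?thesis
    by (simp add: L2_norm_def real_sqrt_mult)
qed

text \<open>Pointwise, the square of \<open>f t\<close> is at most \<open>B\<close> times its
  modulus. This is the bridge from the smoothness of \<open>j\<close> in L2 to radii measured in
  L1.\<close>

lemma L2_norm_le_L1:
  assumes "f \<in> borel_measurable (leb T)" "AE t in leb T. \<bar>f t\<bar> \<le> B"
  shows "(L2_norm T f)\<^sup>2 \<le> B * L1_norm T f"
proof -
  have i: "integrable (leb T) f" by (rule integrable_leb_bounded[OF assms])
  have "integrable (leb T) (\<lambda>t. (f t)\<^sup>2)"
    using L2_bounded[OF assms] by (simp add: L2_def)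
  then have i2: "integrable (leb T) (\<lambda>t. f t * f t)" by (simp add: power2_eq_square)
  have "(L2_norm T f)\<^sup>2 = (LINT t|leb T. f t * f t)"
    by (simp add: L2_norm_def L2_inner_def)
  also have "\<dots> \<le> (LINT t|leb T. B * \<bar>f t\<bar>)"
  proof (rule integral_mono_AE[OF i2])
    show "integrable (leb T) (\<lambda>t. B * \<bar>f t\<bar>)" using i by auto
    show "AE t in leb T. f t * f t \<le> B * \<bar>f t\<bar>"
      using assms(2)
    proof eventually_elim
      case (elim t)
      have "f t * f t = \<bar>f t\<bar> * \<bar>f t\<bar>" by simp
      also have "\<dots> \<le> B * \<bar>f t\<bar>" using elim by (intro mult_right_mono) auto
      finally show ?case .
    qed
  qed
  also have "\<dots> = B * L1_norm T f" by (simp add: L1_norm_def)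
  finally show ?thesis .
qed

lemma L1_norm_nonneg: "0 \<le> L1_norm T f"
  by (simp add: L1_norm_def)

text \<open>\<open>M\<close> and \<open>N\<close> stand for norms of directions and may vanish;
  enlarging them to \<open>M + 1\<close> and \<open>N + 1\<close> avoids dividing by zero when the
  Frechet remainder is rewritten for a real variable.\<close>

lemma DERIV_I_remainder:
  fixes F :: "real \<Rightarrow> real"
  assumes "\<And>e. e > 0 \<Longrightarrow> \<exists>\<delta>>0. \<forall>r. \<bar>r\<bar> * M < \<delta> \<longrightarrow> \<bar>F (s + r) - F s - r * D\<bar> \<le> e * (\<bar>r\<bar> * N)"
    and "0 \<le> M" "0 \<le> N"
  shows "(F has_real_derivative D) (at s)"
  unfolding has_field_derivative_def has_derivative_at_alt
proof (intro conjI allI impI)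
  show "bounded_linear ((*) D)" by (rule bounded_linear_mult_right)
  fix e :: real assume "e > 0"
  then have "e / (N + 1) > 0" using assms(3) by simp
  then obtain \<delta> where \<delta>: "\<delta> > 0"
    "\<And>r. \<bar>r\<bar> * M < \<delta> \<Longrightarrow> \<bar>F (s + r) - F s - r * D\<bar> \<le> e / (N + 1) * (\<bar>r\<bar> * N)"
    using assms(1) by blast
  have "norm (F y - F s - D * (y - s)) \<le> e * norm (y - s)" if "norm (y - s) < \<delta> / (M + 1)" for y
  proof -
    have "\<bar>y - s\<bar> * M \<le> \<bar>y - s\<bar> * (M + 1)" by (intro mult_left_mono) auto
    also have "\<dots> < \<delta>" using that assms(2) by (simp add: field_simps)
    finally have "\<bar>F (s + (y - s)) - F s - (y - s) * D\<bar> \<le> e / (N + 1) * (\<bar>y - s\<bar> * N)"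
      by (rule \<delta>(2))
    also have "\<dots> \<le> e / (N + 1) * (\<bar>y - s\<bar> * (N + 1))"
      using \<open>e > 0\<close> assms(3) by (intro mult_left_mono) auto
    also have "\<dots> = e * \<bar>y - s\<bar>" using assms(3) by simp
    finally show ?thesis by (simp add: mult.commute)
  qed
  then show "\<exists>d>0. \<forall>y. norm (y - s) < d \<longrightarrow> norm (F y - F s - D * (y - s)) \<le> e * norm (y - s)"
    using \<delta>(1) assms(2) by (intro exI[of _ "\<delta> / (M + 1)"]) auto
qed

lemma L2_linear_scaled: "L2_linear T A \<Longrightarrow> u \<in> L2 T \<Longrightarrow> A (\<lambda>t. c * u t) = c * A u"
  unfolding L2_linear_def by blast

text \<open>Restriction to a line makes the mean value theorem and the uniqueness of derivatives of
  real functions available.\<close>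

lemma has_L2_derivative_line:
  assumes "has_L2_derivative T g (\<lambda>t. u t + s * h t) A" "h \<in> L2 T"
  shows "((\<lambda>s. g (\<lambda>t. u t + s * h t)) has_real_derivative A h) (at s)"
proof (rule DERIV_I_remainder[where M = "L2_norm T h" and N = "L2_norm T h"])
  fix e :: real assume "e > 0"
  then obtain \<delta> where \<delta>: "\<delta> > 0" "\<And>k. k \<in> L2 T \<Longrightarrow> L2_norm T k < \<delta> \<Longrightarrow>
      \<bar>g (\<lambda>t. (u t + s * h t) + k t) - g (\<lambda>t. u t + s * h t) - A k\<bar> \<le> e * L2_norm T k"
    using assms(1) unfolding has_L2_derivative_def by blast
  have "\<bar>g (\<lambda>t. u t + (s + r) * h t) - g (\<lambda>t. u t + s * h t) - r * A h\<bar> \<le> e * (\<bar>r\<bar> * L2_norm T h)"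
    if "\<bar>r\<bar> * L2_norm T h < \<delta>" for r
  proof -
    have "(\<lambda>t. r * h t) \<in> L2 T"
      using assms(2) by (auto simp: L2_def power_mult_distrib)
    moreover have "A (\<lambda>t. r * h t) = r * A h"
      using assms unfolding has_L2_derivative_def L2_bounded_linear_def by (blast intro: L2_linear_scaled)
    moreover have "(\<lambda>t. (u t + s * h t) + r * h t) = (\<lambda>t. u t + (s + r) * h t)"
      by (simp add: fun_eq_iff algebra_simps)
    ultimately show ?thesis
      using \<delta>(2)[of "\<lambda>t. r * h t"] that by (simp add: L2_norm_scaled)
  qed
  then show "\<exists>\<delta>>0. \<forall>r. \<bar>r\<bar> * L2_norm T h < \<delta> \<longrightarrow>
      \<bar>g (\<lambda>t. u t + (s + r) * h t) - g (\<lambda>t. u t + s * h t) - r * A h\<bar> \<le> e * (\<bar>r\<bar> * L2_norm T h)"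
    using \<delta>(1) by blast
qed (rule L2_norm_nonneg)+

lemma has_L2_second_derivative_line:
  assumes "has_L2_second_derivative T Dg (\<lambda>t. u t + s * h t) B" "h \<in> L2 T" "v \<in> L2 T"
  shows "((\<lambda>s. Dg (\<lambda>t. u t + s * h t) v) has_real_derivative B h v) (at s)"
proof (rule DERIV_I_remainder[where M = "L2_norm T h" and N = "L2_norm T h * L2_norm T v"])
  fix e :: real assume "e > 0"
  then obtain \<delta> where \<delta>: "\<delta> > 0" "\<And>k. k \<in> L2 T \<Longrightarrow> L2_norm T k < \<delta> \<Longrightarrow>
      \<bar>Dg (\<lambda>t. (u t + s * h t) + k t) v - Dg (\<lambda>t. u t + s * h t) v - B k v\<bar> \<le> e * L2_norm T k * L2_norm T v"
    using assms(1,3) unfolding has_L2_second_derivative_def by blast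
  have "\<bar>Dg (\<lambda>t. u t + (s + r) * h t) v - Dg (\<lambda>t. u t + s * h t) v - r * B h v\<bar> \<le> e * (\<bar>r\<bar> * (L2_norm T h * L2_norm T v))"
    if "\<bar>r\<bar> * L2_norm T h < \<delta>" for r
  proof -
    have "(\<lambda>t. r * h t) \<in> L2 T"
      using assms(2) by (auto simp: L2_def power_mult_distrib)
    moreover have "L2_linear T (\<lambda>k. B k v)"
      using assms unfolding has_L2_second_derivative_def L2_bounded_bilinear_def by blast
    then have "B (\<lambda>t. r * h t) v = r * B h v"
      using L2_linear_scaled assms(2) by blast
    moreover have "(\<lambda>t. (u t + s * h t) + r * h t) = (\<lambda>t. u t + (s + r) * h t)"
      by (simp add: fun_eq_iff algebra_simps)
    ultimately show ?thesis
      using \<delta>(2)[of "\<lambda>t. r * h t"] that by (simp add: L2_norm_scaled mult.assoc)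
  qed
  then show "\<exists>\<delta>>0. \<forall>r. \<bar>r\<bar> * L2_norm T h < \<delta> \<longrightarrow>
      \<bar>Dg (\<lambda>t. u t + (s + r) * h t) v - Dg (\<lambda>t. u t + s * h t) v - r * B h v\<bar> \<le> e * (\<bar>r\<bar> * (L2_norm T h * L2_norm T v))"
    using \<delta>(1) by blast
qed (simp_all add: L2_norm_nonneg)

section \<open>Estimates for the mollified objective, uniform in the scale\<close>

locale smooth_objective = mollifier \<eta> for \<eta> +
  fixes T C :: real
    and j :: "(real \<Rightarrow> real) \<Rightarrow> real"
    and Dj :: "(real \<Rightarrow> real) \<Rightarrow> (real \<Rightarrow> real) \<Rightarrow> real"
    and D2j :: "(real \<Rightarrow> real) \<Rightarrow> (real \<Rightarrow> real) \<Rightarrow> (real \<Rightarrow> real) \<Rightarrow> real"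
  assumes T_pos: "T > 0" and C_pos: "C > 0"
    and Dj: "\<And>u. u \<in> L2 T \<Longrightarrow> has_L2_derivative T j u (Dj u)"
    and D2j: "\<And>u. u \<in> L2 T \<Longrightarrow> has_L2_second_derivative T Dj u (D2j u)"
    and D2j_bound: "\<And>u \<psi> \<phi>. u \<in> L2 T \<Longrightarrow> \<psi> \<in> L2 T \<Longrightarrow> \<phi> \<in> L2 T \<Longrightarrow>
      \<bar>D2j u \<psi> \<phi>\<bar> \<le> C * L2_norm T \<psi> * L2_norm T \<phi>"
begin

text \<open>Mean value theorem for \<open>Dj\<close> along the segment, with the uniform bound on
  \<open>D2j\<close>. The factor \<open>s\<close> is kept because the lemma is applied at an
  intermediate point.\<close>

lemma Dj_difference:
  assumes "u \<in> L2 T" "h \<in> L2 T" "v \<in> L2 T" "0 \<le> s"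
  shows "\<bar>Dj (\<lambda>t. u t + s * h t) v - Dj u v\<bar> \<le> s * (C * L2_norm T h * L2_norm T v)"
proof (cases "s = 0")
  case False
  have "((\<lambda>x. Dj (\<lambda>t. u t + x * h t) v) has_real_derivative D2j (\<lambda>t. u t + x * h t) h v) (at x)" for x
    by (rule has_L2_second_derivative_line[OF D2j[OF L2_add_scaled[OF assms(1,2)]] assms(2,3)])
  then have "\<exists>z. 0 < z \<and> z < s \<and> Dj (\<lambda>t. u t + s * h t) v - Dj (\<lambda>t. u t + 0 * h t) v
      = (s - 0) * D2j (\<lambda>t. u t + z * h t) h v"
    using False \<open>0 \<le> s\<close>
    by (intro MVT2[where f = "\<lambda>x. Dj (\<lambda>t. u t + x * h t) v" and f' = "\<lambda>x. D2j (\<lambda>t. u t + x * h t) h v"]) simp_all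
  then obtain z where "Dj (\<lambda>t. u t + s * h t) v - Dj (\<lambda>t. u t + 0 * h t) v
      = (s - 0) * D2j (\<lambda>t. u t + z * h t) h v"
    by blast
  then have "\<bar>Dj (\<lambda>t. u t + s * h t) v - Dj u v\<bar> = s * \<bar>D2j (\<lambda>t. u t + z * h t) h v\<bar>"
    using \<open>0 \<le> s\<close> by (simp add: abs_mult)
  then show ?thesis
    using D2j_bound[OF L2_add_scaled[OF assms(1,2), of z] assms(2,3)] \<open>0 \<le> s\<close> by (simp add: mult_left_mono)
qed simp

text \<open>One mean value step reduces the remainder to a difference of first derivatives at an
  intermediate point. The constant \<open>C\<close> instead of \<open>C / 2\<close> is the price,
  and any constant will do.\<close>

lemma quadratic_remainder:
  assumes "u \<in> L2 T" "h \<in> L2 T"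
  shows "\<bar>j (\<lambda>t. u t + h t) - j u - Dj u h\<bar> \<le> C * (L2_norm T h)\<^sup>2"
proof -
  have "((\<lambda>x. j (\<lambda>t. u t + x * h t)) has_real_derivative Dj (\<lambda>t. u t + x * h t) h) (at x)" for x
    by (rule has_L2_derivative_line[OF Dj[OF L2_add_scaled[OF assms]] assms(2)])
  then have "\<exists>z. 0 < z \<and> z < 1 \<and> j (\<lambda>t. u t + 1 * h t) - j (\<lambda>t. u t + 0 * h t)
      = (1 - 0) * Dj (\<lambda>t. u t + z * h t) h"
    by (intro MVT2[where f = "\<lambda>x. j (\<lambda>t. u t + x * h t)" and f' = "\<lambda>x. Dj (\<lambda>t. u t + x * h t) h"]) simp_all
  then obtain z where z: "0 < z" "z < 1" "j (\<lambda>t. u t + 1 * h t) - j (\<lambda>t. u t + 0 * h t)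
      = (1 - 0) * Dj (\<lambda>t. u t + z * h t) h"
    by blast
  then have "\<bar>j (\<lambda>t. u t + h t) - j u - Dj u h\<bar> = \<bar>Dj (\<lambda>t. u t + z * h t) h - Dj u h\<bar>"
    by simp
  also have "\<dots> \<le> z * (C * L2_norm T h * L2_norm T h)"
    using z assms by (intro Dj_difference) auto
  also have "\<dots> \<le> 1 * (C * L2_norm T h * L2_norm T h)"
    using z C_pos L2_norm_nonneg by (intro mult_right_mono mult_nonneg_nonneg) auto
  finally show ?thesis by (simp add: power2_eq_square mult.assoc)
qed

text \<open>\<open>Dj\<close> is bounded at the zero function and Lipschitz, hence bounded on every
  L2-bounded set, in particular on all mollified iterates at once.\<close>

lemma Dj_growth:
  obtains M where "0 \<le> M" "\<And>u v. u \<in> L2 T \<Longrightarrow> v \<in> L2 T \<Longrightarrow> \<bar>Dj u v\<bar> \<le> (M + C * L2_norm T u) * L2_norm T v"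
proof -
  have z: "(\<lambda>_. 0) \<in> L2 T" by (rule L2_bounded[of _ _ 0]) auto
  obtain M where M: "\<And>v. v \<in> L2 T \<Longrightarrow> \<bar>Dj (\<lambda>_. 0) v\<bar> \<le> M * L2_norm T v"
    using Dj[OF z] unfolding has_L2_derivative_def L2_bounded_linear_def by blast
  have "\<bar>Dj u v\<bar> \<le> (max 0 M + C * L2_norm T u) * L2_norm T v" if "u \<in> L2 T" "v \<in> L2 T" for u v
  proof -
    have "\<bar>Dj u v - Dj (\<lambda>_. 0) v\<bar> \<le> C * L2_norm T u * L2_norm T v"
      using Dj_difference[OF z that, of 1] by simp
    moreover have "M * L2_norm T v \<le> max 0 M * L2_norm T v"
      by (intro mult_right_mono L2_norm_nonneg) auto
    ultimately show ?thesis
      using M[OF that(2)] by (simp add: distrib_right)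
  qed
  then show ?thesis using that[of "max 0 M"] by simp
qed

text \<open>A chain rule by uniqueness of derivatives: both sides are the derivative at 0 of the
  same real function, since mollification carries the line through \<open>f\<close> in direction
  \<open>d\<close> to a line. The adjoint of mollification never enters.\<close>

lemma gradient_mollified:
  assumes f: "f \<in> borel_measurable (leb T)" "AE t in leb T. \<bar>f t\<bar> \<le> B" "0 \<le> B"
    and d: "d \<in> borel_measurable (leb T)" "AE t in leb T. \<bar>d t\<bar> \<le> B'" "0 \<le> B'" and "h > 0"
    and G: "has_L2_gradient T (j \<circ> mollify \<eta> T h) f Gf"
  shows "L2_inner T Gf d = Dj (mollify \<eta> T h f) (mollify \<eta> T h d)"
proof -
  let ?K = "mollify \<eta> T h"
  have K: "?K f \<in> L2 T" "?K d \<in> L2 T"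
    using mollify_L1_bound(1,2)[OF f \<open>h > 0\<close>] mollify_L1_bound(1,2)[OF d \<open>h > 0\<close>]
    by (auto intro!: L2_bounded borel_measurable_lebI)
  have "((\<lambda>s. (j \<circ> ?K) (\<lambda>t. f t + s * d t)) has_real_derivative L2_inner T Gf d) (at 0)"
    using G L2_bounded[OF d(1,2)] unfolding has_L2_gradient_def
    by (intro has_L2_derivative_line[where s = 0 and u = f and h = d]) (simp_all add: comp_def)
  then have "((\<lambda>s. j (\<lambda>t. ?K f t + s * ?K d t)) has_real_derivative L2_inner T Gf d) (at 0)"
    by (simp add: mollify_affine[OF f d \<open>h > 0\<close>])
  moreover have "((\<lambda>s. j (\<lambda>t. ?K f t + s * ?K d t)) has_real_derivative Dj (?K f) (?K d)) (at 0)"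
    using Dj[OF K(1)] K(2) by (intro has_L2_derivative_line[where s = 0 and u = "?K f" and h = "?K d"]) simp_all
  ultimately show ?thesis by (rule DERIV_unique)
qed

text \<open>The order of quantifiers matters: \<open>B\<close> and \<open>\<Gamma>\<close> are found
  before \<open>h\<close>, \<open>w\<close> and \<open>d\<close>. The remainder involves the square
  of the L2 norm of the mollified step and is linear in the L1 norm; the first-order term involves
  the norm itself and only yields a square root.\<close>

lemma model_estimates:
  assumes "finite W"
  obtains B \<Gamma> where "B > 0" "\<Gamma> \<ge> 0"
    "\<And>h w d Gw. h > 0 \<Longrightarrow> w \<in> BVW T W \<Longrightarrow> (\<lambda>t. w t + d t) \<in> BVW T W \<Longrightarrow>
      has_L2_gradient T (j \<circ> mollify \<eta> T h) w Gw \<Longrightarrow>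
      \<bar>(j \<circ> mollify \<eta> T h) (\<lambda>t. w t + d t) - (j \<circ> mollify \<eta> T h) w - L2_inner T Gw d\<bar> \<le> B * L1_norm T d \<and>
      \<bar>L2_inner T Gw d\<bar> \<le> \<Gamma> * sqrt (L1_norm T d)"
proof -
  define b where "b = abs_bound W"
  have b: "0 \<le> b" by (simp add: b_def abs_bound_nonneg)
  obtain M where M: "0 \<le> M" "\<And>u v. u \<in> L2 T \<Longrightarrow> v \<in> L2 T \<Longrightarrow> \<bar>Dj u v\<bar> \<le> (M + C * L2_norm T u) * L2_norm T v"
    using Dj_growth by blast
  \<comment> \<open>The first root bounds the L2 norm of a mollified \<open>W\<close>-valued
    function; \<open>sqrt (2 * b)\<close> comes from steps being differences of two functions
    bounded by \<open>b\<close>. In the constant for the remainder below, the summand 1 keeps it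
    positive when \<open>b = 0\<close>.\<close>
  define \<Gamma> where "\<Gamma> = (M + C * sqrt (b * (b * T))) * sqrt (2 * b)"
  have "\<bar>(j \<circ> mollify \<eta> T h) (\<lambda>t. w t + d t) - (j \<circ> mollify \<eta> T h) w - L2_inner T Gw d\<bar> \<le> (C * (2 * b) + 1) * L1_norm T d \<and>
      \<bar>L2_inner T Gw d\<bar> \<le> \<Gamma> * sqrt (L1_norm T d)"
    if h: "h > 0" and w: "w \<in> BVW T W" and wd: "(\<lambda>t. w t + d t) \<in> BVW T W"
      and G: "has_L2_gradient T (j \<circ> mollify \<eta> T h) w Gw" for h w d Gw
  proof -
    let ?K = "mollify \<eta> T h"
    have w1: "w \<in> borel_measurable (leb T)" "AE t in leb T. \<bar>w t\<bar> \<le> b" "0 \<le> b"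
      using BVW_D(1)[OF w] BVW_abs_bound[OF w assms] b by (simp_all add: b_def)
    have "(\<lambda>t. (w t + d t) - w t) \<in> borel_measurable (leb T)"
      by (intro borel_measurable_diff BVW_D(1)[OF wd] BVW_D(1)[OF w])
    moreover have "AE t in leb T. \<bar>d t\<bar> \<le> 2 * b"
      using w1(2) BVW_abs_bound[OF wd assms, folded b_def] by eventually_elim linarith
    ultimately have d1: "d \<in> borel_measurable (leb T)" "AE t in leb T. \<bar>d t\<bar> \<le> 2 * b" "0 \<le> 2 * b"
      using b by simp_all
    note Kw = mollify_L1_bound[OF w1 h] and Kd = mollify_L1_bound[OF d1 h]
    have Kw2: "?K w \<in> L2 T" and Kd2: "?K d \<in> L2 T"
      using Kw(1,2) Kd(1,2) by (auto intro!: L2_bounded borel_measurable_lebI)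
    have "(L2_norm T (?K d))\<^sup>2 \<le> 2 * b * L1_norm T (?K d)"
      using Kd(1,2) by (intro L2_norm_le_L1 borel_measurable_lebI) auto
    also have "\<dots> \<le> 2 * b * L1_norm T d"
      using Kd(3) b by (intro mult_left_mono) auto
    finally have nd: "(L2_norm T (?K d))\<^sup>2 \<le> 2 * b * L1_norm T d" .
    have "(L2_norm T (?K w))\<^sup>2 \<le> b * L1_norm T (?K w)"
      using Kw(1,2) by (intro L2_norm_le_L1 borel_measurable_lebI) auto
    also have "L1_norm T (?K w) \<le> b * T"
    proof -
      have "L1_norm T (?K w) \<le> (LINT t|leb T. b)"
        unfolding L1_norm_def
      proof (rule integral_mono)
        show "integrable (leb T) (\<lambda>t. \<bar>?K w t\<bar>)"
          using Kw(1,2) by (intro integrable_leb_bounded[of _ _ b] borel_measurable_abs borel_measurable_lebI) auto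
        show "integrable (leb T) (\<lambda>t. b)"
          by (rule integrable_leb_bounded[of _ _ b]) (auto simp: b)
      qed (use Kw(2) in auto)
      also have "\<dots> = b * T"
        using T_pos by (simp add: measure_restrict_space)
      finally show ?thesis .
    qed
    finally have nw: "L2_norm T (?K w) \<le> sqrt (b * (b * T))"
      using b by (intro real_le_rsqrt) (simp add: mult_left_mono)
    have nd': "L2_norm T (?K d) \<le> sqrt (2 * b) * sqrt (L1_norm T d)"
      using nd by (simp add: real_sqrt_mult[symmetric] real_le_rsqrt)
    have ip: "L2_inner T Gw d = Dj (?K w) (?K d)"
      by (rule gradient_mollified[OF w1 d1 h G])
    have "?K (\<lambda>t. w t + d t) = (\<lambda>t. ?K w t + ?K d t)"
      using mollify_affine[OF w1 d1 h, of 1] by simp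
    then have "\<bar>(j \<circ> ?K) (\<lambda>t. w t + d t) - (j \<circ> ?K) w - L2_inner T Gw d\<bar> \<le> C * (L2_norm T (?K d))\<^sup>2"
      using quadratic_remainder[OF Kw2 Kd2] by (simp add: ip)
    also have "\<dots> \<le> C * (2 * b * L1_norm T d)"
      using nd C_pos by (intro mult_left_mono) auto
    also have "\<dots> \<le> (C * (2 * b) + 1) * L1_norm T d"
      using L1_norm_nonneg[of T d] by (simp add: algebra_simps)
    finally have 1: "\<bar>(j \<circ> ?K) (\<lambda>t. w t + d t) - (j \<circ> ?K) w - L2_inner T Gw d\<bar> \<le> (C * (2 * b) + 1) * L1_norm T d" .
    have "\<bar>L2_inner T Gw d\<bar> \<le> (M + C * L2_norm T (?K w)) * L2_norm T (?K d)"
      unfolding ip by (rule M(2)[OF Kw2 Kd2])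
    also have "\<dots> \<le> (M + C * sqrt (b * (b * T))) * (sqrt (2 * b) * sqrt (L1_norm T d))"
      using nw nd' M(1) C_pos b T_pos L2_norm_nonneg by (intro mult_mono add_left_mono mult_left_mono) auto
    finally have "\<bar>L2_inner T Gw d\<bar> \<le> \<Gamma> * sqrt (L1_norm T d)"
      by (simp add: \<Gamma>_def mult.assoc)
    with 1 show ?thesis by blast
  qed
  moreover have "C * (2 * b) + 1 > 0" "\<Gamma> \<ge> 0"
    using C_pos b M(1) T_pos by (auto simp: \<Gamma>_def intro!: add_nonneg_pos)
  ultimately show ?thesis using that by blast
qed

end

section \<open>Invariants of the algorithm and consequences of its stopping rules\<close>

lemma tr_minimizer_BVW:
  assumes min: "tr_minimizer T \<alpha> W G w \<Delta> d" and w: "w \<in> BVW T W" and "0 \<le> \<Delta>" "\<alpha> > 0" "finite W"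
  shows "(\<lambda>t. w t + d t) \<in> BVW T W"
proof -
  obtain V where V: "TV T w = ereal V" using BVW_TV_real[OF w] .
  have d: "d \<in> L2 T" "AE s in leb T. w s + d s \<in> real_of_int ` W"
    using min unfolding tr_minimizer_def tr_feasible_def by auto
  have "(\<lambda>_. 0) \<in> tr_feasible T W w \<Delta>"
    using BVW_D(4)[OF w] \<open>0 \<le> \<Delta>\<close> L2_bounded[of "\<lambda>_. 0" T 0]
    by (simp add: tr_feasible_def L1_norm_def)
  \<comment> \<open>The zero step is feasible and has model value 0, so a minimizer cannot produce
    infinite total variation.\<close>
  then have "tr_model T \<alpha> G w d \<le> tr_model T \<alpha> G w (\<lambda>_. 0)"
    using min unfolding tr_minimizer_def by blast
  also have "\<dots> = 0"
    by (simp add: tr_model_def L2_inner_def V zero_ereal_def)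
  finally have "TV T (\<lambda>t. w t + d t) < \<infinity>"
    using \<open>\<alpha> > 0\<close> V unfolding tr_model_def by (cases "TV T (\<lambda>t. w t + d t)") auto
  then show ?thesis
    using d BVW_D(1)[OF w] \<open>finite W\<close> by (intro BVW_I) (auto simp: L2_def)
qed

lemma tr_exec_BVW:
  assumes "tr_exec T \<alpha> W \<sigma> \<Delta>0 \<Delta>min pmin g G w \<Delta> w'" "w \<in> BVW T W" "0 < \<Delta>" "0 < \<Delta>0" "\<alpha> > 0" "finite W"
  shows "w' \<in> BVW T W"
  using assms
proof (induction rule: tr_exec.induct)
  case (accept w \<Delta> d w')
  have "(\<lambda>t. w t + d t) \<in> BVW T W"
    using accept.prems by (intro tr_minimizer_BVW[OF accept.hyps(1)]) auto
  then show ?case using accept by blast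
qed auto

text \<open>The invariant is that the radius stays at least \<open>\<delta>\<close>: rejections
  occur only above \<open>2 * \<delta>\<close>, so halving keeps it, and acceptance resets the
  radius to \<open>\<Delta>0\<close>. Since \<open>\<Delta>min\<close> is at most
  \<open>\<delta>\<close>, the only remaining exit is the criterion on the predicted
  reduction.\<close>

lemma tr_exec_radius:
  assumes "tr_exec T \<alpha> W \<sigma> \<Delta>0 \<Delta>min pmin g G w \<Delta> w'" "w \<in> BVW T W" "\<delta> \<le> \<Delta>"
    and "0 < \<delta>" "\<delta> \<le> \<Delta>0" "\<Delta>min \<le> \<delta>" "\<alpha> > 0" "finite W"
    and rej: "\<And>w \<Delta> d. w \<in> BVW T W \<Longrightarrow> 0 < \<Delta> \<Longrightarrow> tr_minimizer T \<alpha> W G w \<Delta> d \<Longrightarrow>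
      \<not> pred_red T \<alpha> G w d < ereal pmin \<Longrightarrow>
      actual_red T \<alpha> g w d / pred_red T \<alpha> G w d < ereal \<sigma> \<Longrightarrow> 2 * \<delta> < \<Delta>"
  shows "\<exists>\<Delta>' d. \<delta> \<le> \<Delta>' \<and> tr_minimizer T \<alpha> W G w' \<Delta>' d \<and> pred_red T \<alpha> G w' d < ereal pmin"
  using assms(1-3)
proof (induction rule: tr_exec.induct)
  case (stop_pred w \<Delta> d)
  then show ?case by blast
next
  case (stop_radius w \<Delta> d)
  then have "2 * \<delta> < \<Delta>" using \<open>0 < \<delta>\<close> by (intro rej) auto
  then show ?case using stop_radius.hyps(4) \<open>\<Delta>min \<le> \<delta>\<close> by linarith
next
  case (reject w \<Delta> d w')
  then have "2 * \<delta> < \<Delta>" using \<open>0 < \<delta>\<close> by (intro rej) auto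
  then show ?case using reject by auto
next
  case (accept w \<Delta> d w')
  have "(\<lambda>t. w t + d t) \<in> BVW T W"
    using accept.prems \<open>0 < \<delta>\<close> assms(7,8) by (intro tr_minimizer_BVW[OF accept.hyps(1)]) auto
  then show ?case using accept \<open>\<delta> \<le> \<Delta>0\<close> by blast
qed

text \<open>The total variation terms in actual and predicted reduction coincide, so the two differ
  only by the linearization error of \<open>g\<close>, at most \<open>B * \<Delta>\<close>.
  Rejection makes the difference exceed \<open>(1 - \<sigma>)\<close> times a predicted reduction
  that is at least \<open>p\<close>.\<close>

lemma rejected_radius:
  assumes w: "w \<in> BVW T W" and wd: "(\<lambda>t. w t + d t) \<in> BVW T W"
    and rem: "\<bar>g (\<lambda>t. w t + d t) - g w - L2_inner T (G w) d\<bar> \<le> B * L1_norm T d"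
    and "L1_norm T d \<le> \<Delta>" "0 \<le> B" "0 < p" "\<sigma> < 1"
    and pred: "\<not> pred_red T \<alpha> G w d < ereal p"
    and rej: "actual_red T \<alpha> g w d / pred_red T \<alpha> G w d < ereal \<sigma>"
  shows "(1 - \<sigma>) * p < B * \<Delta>"
proof -
  obtain V where V: "TV T w = ereal V" using BVW_TV_real[OF w] .
  obtain V' where V': "TV T (\<lambda>t. w t + d t) = ereal V'" using BVW_TV_real[OF wd] .
  define P where "P = - L2_inner T (G w) d - \<alpha> * V' + \<alpha> * V"
  define A where "A = g w + \<alpha> * V - g (\<lambda>t. w t + d t) - \<alpha> * V'"
  have "pred_red T \<alpha> G w d = ereal P" "actual_red T \<alpha> g w d = ereal A"
    by (simp_all add: pred_red_def tr_model_def actual_red_def V V' P_def A_def)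
  then have P: "p \<le> P" and "A / P < \<sigma>"
    using pred rej \<open>0 < p\<close> by auto
  then have "A < \<sigma> * P"
    using \<open>0 < p\<close> by (simp add: divide_less_eq)
  moreover have "P - B * L1_norm T d \<le> A"
    using rem unfolding P_def A_def by linarith
  moreover have "B * L1_norm T d \<le> B * \<Delta>"
    using assms(4,5) by (rule mult_left_mono)
  ultimately have "(1 - \<sigma>) * P < B * \<Delta>"
    by (simp add: algebra_simps)
  moreover have "(1 - \<sigma>) * p \<le> (1 - \<sigma>) * P"
    using P \<open>\<sigma> < 1\<close> by (intro mult_left_mono) auto
  ultimately show ?thesis by linarith
qed

text \<open>The step from \<open>w\<close> to \<open>v\<close> is a competitor in the last
  subproblem. Its predicted reduction cannot exceed that of the minimizer, which is below
  \<open>p\<close>.\<close>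

lemma TV_gap:
  assumes w: "w \<in> BVW T W" and v: "v \<in> BVW T W" and "finite W"
    and min: "tr_minimizer T \<alpha> W G w \<Delta> d" and pred: "pred_red T \<alpha> G w d < ereal p"
    and close: "L1_norm T (\<lambda>t. v t - w t) \<le> \<Delta>"
    and V: "TV T w = ereal V" "TV T v = ereal V'"
  shows "\<alpha> * (V - V') < p + L2_inner T (G w) (\<lambda>t. v t - w t)"
proof -
  have "(\<lambda>t. v t - w t) \<in> L2 T"
    using L2_add_scaled[of v T w "-1"] BVW_D(1)[OF w] BVW_D(1)[OF v]
      BVW_abs_bound[OF w \<open>finite W\<close>] BVW_abs_bound[OF v \<open>finite W\<close>] L2_bounded by simp
  then have "(\<lambda>t. v t - w t) \<in> tr_feasible T W w \<Delta>"
    using BVW_D(4)[OF v] close by (simp add: tr_feasible_def)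
  then have "tr_model T \<alpha> G w d \<le> tr_model T \<alpha> G w (\<lambda>t. v t - w t)"
    using min unfolding tr_minimizer_def by blast
  also have "\<dots> = ereal (L2_inner T (G w) (\<lambda>t. v t - w t) + \<alpha> * V' - \<alpha> * V)"
    by (simp add: tr_model_def V)
  finally have "- ereal (L2_inner T (G w) (\<lambda>t. v t - w t) + \<alpha> * V' - \<alpha> * V) \<le> pred_red T \<alpha> G w d"
    unfolding pred_red_def by (simp only: ereal_minus_le_minus)
  also have "\<dots> < ereal p" by (rule pred)
  finally show ?thesis by (simp add: algebra_simps)
qed

theorem proposition4p11:
  fixes T \<alpha> \<Delta>0 \<sigma> a C :: real
    and W :: "int set"
    and \<eta> :: "real \<Rightarrow> real"
    and j :: "(real \<Rightarrow> real) \<Rightarrow> real"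
    and Dj :: "(real \<Rightarrow> real) \<Rightarrow> (real \<Rightarrow> real) \<Rightarrow> real"
    and D2j :: "(real \<Rightarrow> real) \<Rightarrow> (real \<Rightarrow> real) \<Rightarrow> (real \<Rightarrow> real) \<Rightarrow> real"
    and \<epsilon> :: "nat \<Rightarrow> real"
    and \<Delta> :: "real \<Rightarrow> real"
    and w_init :: "real \<Rightarrow> real"
    and w :: "nat \<Rightarrow> real \<Rightarrow> real"
  assumes "T > 0" and "\<alpha> > 0" and "\<Delta>0 > 0" and "0 < \<sigma>" and "\<sigma> < 1"
    and "finite W"
    and "0 < a" and "a \<le> 1 - \<sigma>"
    and "mollifier_kernel \<eta>"
    and "L2_functional T j"
    and "\<exists>c. \<forall>u\<in>L2 T. c \<le> j u"
    and "\<forall>u\<in>L2 T. has_L2_derivative T j u (Dj u)"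
    and "\<forall>u\<in>L2 T. has_L2_second_derivative T Dj u (D2j u)"
    and "C > 0"
    and "\<forall>u\<in>L2 T. \<forall>\<psi>\<in>L2 T. \<forall>\<phi>\<in>L2 T. \<bar>D2j u \<psi> \<phi>\<bar> \<le> C * L2_norm T \<psi> * L2_norm T \<phi>"
    and "\<forall>n. \<epsilon> n > 0" and "\<epsilon> \<longlonglongrightarrow> 0"
    and "\<forall>n. \<Delta> (\<epsilon> n) > 0" and "(\<lambda>n. \<Delta> (\<epsilon> n)) \<longlonglongrightarrow> 0"
    and "w_init \<in> BVW T W"
    and "\<forall>n. tr_algorithm T \<alpha> W \<sigma> \<Delta>0 (\<Delta> (\<epsilon> n)) ((1 - 3 * a / 4) * \<alpha>) (j \<circ> mollify \<eta> T (\<epsilon> n))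
               (case n of 0 \<Rightarrow> w_init | Suc m \<Rightarrow> w m) (w n)"
  shows "(liminf (\<lambda>n. TV T (w n)) < \<infinity> \<longrightarrow>
            (\<exists>r v. strict_mono r \<and> weak_star_conv T (w \<circ> r) v)) \<and>
         (\<forall>r v. strict_mono r \<and> weak_star_conv T (w \<circ> r) v \<longrightarrow>
            strict_conv T (w \<circ> r) v \<and> v \<in> BVW T W)"
proof -
  interpret smooth_objective \<eta> T C j Dj D2j
    by unfold_locales (use assms(1,9,12-15) in simp_all)
  note finW = \<open>finite W\<close>
  define p where "p = (1 - 3 * a / 4) * \<alpha>"
  \<comment> \<open>Positivity comes from \<open>a < 1\<close>. The strict inequality comes from
    \<open>a > 0\<close> and leaves the gap \<open>3 * a * \<alpha> / 4\<close>, which later absorbs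
    the first-order term.\<close>
  have p: "0 < p" "p < \<alpha>"
    using assms(2,4,7,8) by (auto simp: p_def)
  define w0 where "w0 n = (case n of 0 \<Rightarrow> w_init | Suc m \<Rightarrow> w m)" for n
  let ?g = "\<lambda>n. j \<circ> mollify \<eta> T (\<epsilon> n)"
  have "\<forall>n. \<exists>G. (\<forall>u\<in>L2 T. has_L2_gradient T (?g n) u (G u)) \<and>
      tr_exec T \<alpha> W \<sigma> \<Delta>0 (\<Delta> (\<epsilon> n)) p (?g n) G (w0 n) \<Delta>0 (w n)"
    using assms(21) unfolding tr_algorithm_def p_def w0_def by blast
  then obtain G where grad: "\<And>n u. u \<in> L2 T \<Longrightarrow> has_L2_gradient T (?g n) u (G n u)"
    and exec: "\<And>n. tr_exec T \<alpha> W \<sigma> \<Delta>0 (\<Delta> (\<epsilon> n)) p (?g n) (G n) (w0 n) \<Delta>0 (w n)"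
    using choice[of "\<lambda>n G. (\<forall>u\<in>L2 T. has_L2_gradient T (?g n) u (G u)) \<and>
      tr_exec T \<alpha> W \<sigma> \<Delta>0 (\<Delta> (\<epsilon> n)) p (?g n) G (w0 n) \<Delta>0 (w n)"] by blast
  have w0: "w0 n \<in> BVW T W" for n
  proof (induction n)
    case 0
    then show ?case using assms(20) by (simp add: w0_def)
  next
    case (Suc n)
    then show ?case
      using tr_exec_BVW[OF exec Suc assms(3,3,2) finW] by (simp add: w0_def)
  qed
  have w: "w n \<in> BVW T W" for n
    using w0[of "Suc n"] by (simp add: w0_def)
  have L2: "u \<in> L2 T" if "u \<in> BVW T W" for u
    by (rule L2_bounded[OF BVW_D(1)[OF that] BVW_abs_bound[OF that finW]])
  obtain B \<Gamma> where B: "B > 0" "\<Gamma> \<ge> 0"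
    and est: "\<And>h w d Gw. h > 0 \<Longrightarrow> w \<in> BVW T W \<Longrightarrow> (\<lambda>t. w t + d t) \<in> BVW T W \<Longrightarrow>
      has_L2_gradient T (j \<circ> mollify \<eta> T h) w Gw \<Longrightarrow>
      \<bar>(j \<circ> mollify \<eta> T h) (\<lambda>t. w t + d t) - (j \<circ> mollify \<eta> T h) w - L2_inner T Gw d\<bar> \<le> B * L1_norm T d \<and>
      \<bar>L2_inner T Gw d\<bar> \<le> \<Gamma> * sqrt (L1_norm T d)"
    using model_estimates[OF finW] by blast
  \<comment> \<open>Half of \<open>(1 - \<sigma>) * p / B\<close>, the radius up to which no step is
    rejected, so that the radius is still at least \<open>\<delta>\<close> after a halving; the
    minimum with \<open>\<Delta>0\<close> covers the start of each inner loop.\<close>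
  define \<delta> where "\<delta> = min \<Delta>0 ((1 - \<sigma>) * p / (2 * B))"
  have \<delta>: "0 < \<delta>" "\<delta> \<le> \<Delta>0" "2 * B * \<delta> \<le> (1 - \<sigma>) * p"
  proof -
    have "2 * B * \<delta> \<le> 2 * B * ((1 - \<sigma>) * p / (2 * B))"
      using B by (intro mult_left_mono) (auto simp: \<delta>_def)
    then show "2 * B * \<delta> \<le> (1 - \<sigma>) * p" using B by simp
  qed (use assms(3,5) p B in \<open>auto simp: \<delta>_def\<close>)
  have stop: "\<exists>\<Delta>' d. \<delta> \<le> \<Delta>' \<and> tr_minimizer T \<alpha> W (G n) (w n) \<Delta>' d \<and> pred_red T \<alpha> (G n) (w n) d < ereal p"
    if "\<Delta> (\<epsilon> n) \<le> \<delta>" for n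
  proof (rule tr_exec_radius[OF exec w0 \<delta>(2,1,2) that assms(2) finW])
    fix u :: "real \<Rightarrow> real" and \<Delta>' d
    assume u: "u \<in> BVW T W" "0 < \<Delta>'" "tr_minimizer T \<alpha> W (G n) u \<Delta>' d"
      and rej: "\<not> pred_red T \<alpha> (G n) u d < ereal p" "actual_red T \<alpha> (?g n) u d / pred_red T \<alpha> (G n) u d < ereal \<sigma>"
    have ud: "(\<lambda>t. u t + d t) \<in> BVW T W"
      using u assms(2) by (intro tr_minimizer_BVW[OF u(3,1) _ _ finW]) auto
    have "L1_norm T d \<le> \<Delta>'"
      using u(3) by (simp add: tr_minimizer_def tr_feasible_def)
    then have "(1 - \<sigma>) * p < B * \<Delta>'"
      using est[OF _ u(1) ud grad[OF L2[OF u(1)]], of n] assms(16) B p assms(5) rej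
      by (intro rejected_radius[OF u(1) ud, where g = "?g n" and G = "G n" and B = B]) auto
    then have "B * (2 * \<delta>) < B * \<Delta>'" using \<delta>(3) by simp
    then show "2 * \<delta> < \<Delta>'" using B by simp
  qed
  show ?thesis
  proof (intro conjI impI allI)
    assume "liminf (\<lambda>n. TV T (w n)) < \<infinity>"
    then obtain M where M: "liminf (\<lambda>n. TV T (w n)) < ereal M"
      using less_PInf_Ex_of_nat by (metis ereal_dense2)
    \<comment> \<open>A finite lower limit bounds \<open>TV\<close> only along infinitely many
      indices; enumerating them gives the sequence to which compactness applies.\<close>
    have "infinite {n. TV T (w n) < ereal M}"
    proof
      assume "finite {n. TV T (w n) < ereal M}"
      then have "eventually (\<lambda>n. \<not> TV T (w n) < ereal M) sequentially"
        by (simp add: eventually_cofinite cofinite_eq_sequentially[symmetric])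
      then have "eventually (\<lambda>n. ereal M \<le> TV T (w n)) sequentially"
        by (simp add: not_less)
      then have "ereal M \<le> liminf (\<lambda>n. TV T (w n))"
        by (rule Liminf_bounded)
      with M show False by simp
    qed
    then obtain r :: "nat \<Rightarrow> nat" where r: "strict_mono r" "\<And>n. TV T (w (r n)) < ereal M"
      using infinite_enumerate by (metis mem_Collect_eq)
    then have rM: "TV T (w (r n)) \<le> ereal M" for n by (simp add: less_imp_le)
    obtain r' v where r': "strict_mono r'" "v \<in> BVW T W"
      "(\<lambda>n. L1_norm T (\<lambda>t. w (r (r' n)) t - v t)) \<longlonglongrightarrow> 0"
      using BVW_compact[of T W "\<lambda>n. w (r n)" M, OF assms(1) finW w rM] by blast
    have "limsup (\<lambda>n. TV T (w (r (r' n)))) \<le> ereal M"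
      using r(2) by (intro Limsup_bounded always_eventually) (auto intro: less_imp_le)
    then have "limsup (\<lambda>n. TV T (w (r (r' n)))) < \<infinity>"
      by (rule order.strict_trans1) simp
    moreover have "u \<in> BV T" if "u \<in> BVW T W" for u
      using that by (simp add: BVW_def)
    ultimately have "weak_star_conv T (w \<circ> (r \<circ> r')) v"
      using w r' unfolding weak_star_conv_def by simp
    then show "\<exists>r v. strict_mono r \<and> weak_star_conv T (w \<circ> r) v"
      using strict_mono_o[OF r(1) r'(1)] by blast
  next
    fix r v assume rv: "strict_mono r \<and> weak_star_conv T (w \<circ> r) v"
    then have lim: "(\<lambda>n. L1_norm T (\<lambda>t. w (r n) t - v t)) \<longlonglongrightarrow> 0" and "v \<in> BV T"
      by (simp_all add: weak_star_conv_def)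
    then have vi: "integrable (leb T) v" and vTV: "TV T v < \<infinity>"
      by (simp_all add: BV_def)
    have "AE t in leb T. v t \<in> real_of_int ` W"
      using finW by (intro AE_closed_L1_limit[OF BVW_D(2)[OF w] vi lim] finite_imp_closed finite_imageI BVW_D(4)[OF w])
    then show v: "v \<in> BVW T W"
      using vi vTV finW by (intro BVW_I) auto
    obtain k where k: "TV T v = ereal (of_int k)"
      using BVW_TV_integer[OF assms(1) finW v] by blast
    \<comment> \<open>Three conditions are needed eventually: the step to \<open>v\<close> fits into
      the guaranteed final radius, the first-order term is below the gap
      \<open>\<alpha> - p\<close>, and the radius criterion is out of reach.\<close>
    have "eventually (\<lambda>n. L1_norm T (\<lambda>t. w (r n) t - v t) < \<delta>) sequentially"
      using lim \<delta>(1) by (rule order_tendstoD)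
    moreover have "eventually (\<lambda>n. \<Gamma> * sqrt (L1_norm T (\<lambda>t. w (r n) t - v t)) < \<alpha> - p) sequentially"
    proof -
      have "(\<lambda>n. \<Gamma> * sqrt (L1_norm T (\<lambda>t. w (r n) t - v t))) \<longlonglongrightarrow> \<Gamma> * sqrt 0"
        by (intro tendsto_intros lim)
      then show ?thesis using p by (intro order_tendstoD) auto
    qed
    moreover have "eventually (\<lambda>n. \<Delta> (\<epsilon> (r n)) < \<delta>) sequentially"
      using LIMSEQ_subseq_LIMSEQ[OF assms(19), of r] rv \<delta>(1) by (intro order_tendstoD) (auto simp: o_def)
    ultimately have "eventually (\<lambda>n. TV T (w (r n)) \<le> TV T v) sequentially"
    proof eventually_elim
      case (elim n)
      obtain kn where kn: "TV T (w (r n)) = ereal (of_int kn)"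
        using BVW_TV_integer[OF assms(1) finW w] by blast
      have sym: "L1_norm T (\<lambda>t. v t - w (r n) t) = L1_norm T (\<lambda>t. w (r n) t - v t)"
        by (simp add: L1_norm_def abs_minus_commute)
      obtain \<Delta>' d where d: "\<delta> \<le> \<Delta>'" "tr_minimizer T \<alpha> W (G (r n)) (w (r n)) \<Delta>' d"
        "pred_red T \<alpha> (G (r n)) (w (r n)) d < ereal p"
        using stop[of "r n"] elim(3) by auto
      have "L1_norm T (\<lambda>t. v t - w (r n) t) \<le> \<Delta>'"
        using elim(1) d(1) sym by simp
      then have "\<alpha> * (of_int kn - of_int k) < p + L2_inner T (G (r n) (w (r n))) (\<lambda>t. v t - w (r n) t)"
        by (rule TV_gap[OF w v finW d(2,3) _ kn k])
      moreover have "\<bar>L2_inner T (G (r n) (w (r n))) (\<lambda>t. v t - w (r n) t)\<bar>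
          \<le> \<Gamma> * sqrt (L1_norm T (\<lambda>t. v t - w (r n) t))"
        using est[OF _ w _ grad[OF L2[OF w]], of "r n" "r n" "\<lambda>t. v t - w (r n) t"] v assms(16) by simp
      \<comment> \<open>The bound \<open>p\<close> and the first-order term below
        \<open>\<alpha> - p\<close> add up to less than \<open>\<alpha>\<close>, so two integers
        differ by less than 1 and the excess of \<open>kn\<close> over \<open>k\<close> is at most
        0.\<close>
      ultimately have "\<alpha> * (of_int kn - of_int k) < \<alpha> * 1"
        using elim(2) unfolding sym by linarith
      then have "real_of_int kn - of_int k < 1"
        using assms(2) by (simp only: mult_less_cancel_left_pos)
      then show ?case by (simp add: kn k)
    qed
    then have "limsup (\<lambda>n. TV T (w (r n))) \<le> TV T v"
      by (rule Limsup_bounded)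
    moreover have "TV T v \<le> liminf (\<lambda>n. TV T (w (r n)))"
      by (rule TV_lower_semicontinuous[OF BVW_D(2)[OF w] vi lim])
    moreover have "liminf (\<lambda>n. TV T (w (r n))) \<le> limsup (\<lambda>n. TV T (w (r n)))"
      by (rule Liminf_le_Limsup) simp
    ultimately have "(\<lambda>n. TV T (w (r n))) \<longlonglongrightarrow> TV T v"
      by (subst tendsto_iff_Liminf_eq_Limsup) auto
    then show "strict_conv T (w \<circ> r) v"
      using rv by (simp add: strict_conv_def o_def)
  qed
qed

end
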